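(* Let $R\in\mathbb{C}^{M\times M}$ be Hermitian, and let $\mathcal{B}=\operatorname{span}\{B_1,\ldots,B_d\}\subseteq\mathbb{C}^{M\times M}$ with $B_1,\ldots,B_d$ linearly independent. Define the Hermitian $d\times d$ matrices $$\mathbf{M}_{ij}=\operatorname{Tr}\bigl(B_i^H\,\mathrm{ad}_R^2(B_j)\bigr),\qquad \mathbf{G}_{ij}=\operatorname{Tr}\bigl(B_i^H B_j\bigr).$$ Then the minimizer of $\|[R,A]\|_F^2/\|A\|_F^2$ over $A\in\mathcal{B}\setminus\{0\}$ is $A^\ast=\sum_j c_j^\ast B_j$, where $\mathbf{c}^\ast$ is a generalized eigenvector for the smallest generalized eigenvalue $\lambda_{\min}$ of $\mathbf{M}\mathbf{c}=\lambda\,\mathbf{G}\mathbf{c}$. The computational cost (number of arithmetic operations) is $O(d^2M^3+d^3)$; the dimension $d$ of the pencil is independent of $M$.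
   Context: $[X,Y]=XY-YX$; $X^H$ is the conjugate transpose; $\|X\|_F=\sqrt{\operatorname{Tr}(X^HX)}$ is the Frobenius norm. The double commutator is $\mathrm{ad}_R^2(A)=[R,[R,A]]=R^2A-2RAR+AR^2$. A generalized eigenvector of the pencil for $\lambda$ is a nonzero $\mathbf{c}\in\mathbb{C}^d$ with $\mathbf{M}\mathbf{c}=\lambda\mathbf{G}\mathbf{c}$.
   Formalization: Since arithmetic operations alone cannot produce the smallest generalized eigenvalue exactly, the operation count also allows one non-arithmetic step: the least real root of a polynomial of degree at most n with given coefficients, charged (n+1)^3 by convention. *)

theory Defs
  imports
    "Jordan_Normal_Form.Schur_Decomposition"
    "HOL-Library.Landau_Symbols"
begin

definition hermitian_mat :: "complex mat \<Rightarrow> bool" where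
  "hermitian_mat A \<longleftrightarrow> mat_adjoint A = A"

definition mat_trace :: "complex mat \<Rightarrow> complex" where
  "mat_trace A = (\<Sum>i<dim_row A. A $$ (i, i))"

definition commutator :: "complex mat \<Rightarrow> complex mat \<Rightarrow> complex mat" where
  "commutator X Y = X * Y - Y * X"

definition ad2 :: "complex mat \<Rightarrow> complex mat \<Rightarrow> complex mat" where
  "ad2 R A = commutator R (commutator R A)"

text \<open>The trace below is real and nonnegative, so taking the real part loses nothing.\<close>

definition frobenius_norm :: "complex mat \<Rightarrow> real" where
  "frobenius_norm X = sqrt (Re (mat_trace (mat_adjoint X * X)))"

definition commutator_quotient :: "complex mat \<Rightarrow> complex mat \<Rightarrow> real" where
  "commutator_quotient R A = (frobenius_norm (commutator R A))\<^sup>2 / (frobenius_norm A)\<^sup>2"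

text \<open>A family of \<open>m \<times> m\<close> matrices is a list \<open>Bs\<close>; the coefficients of a linear
  combination form a vector of dimension \<open>length Bs\<close>.\<close>

definition mat_lincomb :: "nat \<Rightarrow> complex mat list \<Rightarrow> complex vec \<Rightarrow> complex mat" where
  "mat_lincomb m Bs c = mat m m (\<lambda>(i, k). \<Sum>j<length Bs. c $ j * (Bs ! j) $$ (i, k))"

definition mat_span :: "nat \<Rightarrow> complex mat list \<Rightarrow> complex mat set" where
  "mat_span m Bs = mat_lincomb m Bs ` carrier_vec (length Bs)"

definition mat_lin_indep :: "nat \<Rightarrow> complex mat list \<Rightarrow> bool" where
  "mat_lin_indep m Bs \<longleftrightarrow>
     (\<forall>c \<in> carrier_vec (length Bs). mat_lincomb m Bs c = 0\<^sub>m m m \<longrightarrow> c = 0\<^sub>v (length Bs))"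

text \<open>The case \<open>d = 0\<close> is excluded: then the span is zero and there is nothing to minimise over.\<close>

definition problem_data :: "nat \<Rightarrow> nat \<Rightarrow> complex mat \<Rightarrow> complex mat list \<Rightarrow> bool" where
  "problem_data d m R Bs \<longleftrightarrow>
     0 < d \<and> R \<in> carrier_mat m m \<and> hermitian_mat R \<and>
     length Bs = d \<and> set Bs \<subseteq> carrier_mat m m \<and> mat_lin_indep m Bs"

definition pencil_M :: "complex mat \<Rightarrow> complex mat list \<Rightarrow> complex mat" where
  "pencil_M R Bs = mat (length Bs) (length Bs)
     (\<lambda>(i, j). mat_trace (mat_adjoint (Bs ! i) * ad2 R (Bs ! j)))"

definition pencil_G :: "complex mat list \<Rightarrow> complex mat" where
  "pencil_G Bs = mat (length Bs) (length Bs)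
     (\<lambda>(i, j). mat_trace (mat_adjoint (Bs ! i) * (Bs ! j)))"

definition gen_eigenvector :: "complex mat \<Rightarrow> complex mat \<Rightarrow> complex \<Rightarrow> complex vec \<Rightarrow> bool" where
  "gen_eigenvector P Q l c \<longleftrightarrow>
     c \<in> carrier_vec (dim_row P) \<and> c \<noteq> 0\<^sub>v (dim_row P) \<and> P *\<^sub>v c = l \<cdot>\<^sub>v (Q *\<^sub>v c)"

definition gen_eigenvalue :: "complex mat \<Rightarrow> complex mat \<Rightarrow> complex \<Rightarrow> bool" where
  "gen_eigenvalue P Q l \<longleftrightarrow> (\<exists>c. gen_eigenvector P Q l c)"

definition smallest_gen_eigenvalue :: "complex mat \<Rightarrow> complex mat \<Rightarrow> real \<Rightarrow> bool" where
  "smallest_gen_eigenvalue P Q l \<longleftrightarrow>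
     gen_eigenvalue P Q (of_real l) \<and> (\<forall>\<mu>. gen_eigenvalue P Q \<mu> \<longrightarrow> \<mu> \<in> \<real> \<and> l \<le> Re \<mu>)"

text \<open>Loop-free register programs over the complex numbers (algebraic computation trees).
  The first argument of an instruction is its target register. \<open>IfPos a P Q\<close> branches on the
  sign of the real part of register \<open>a\<close>. The only constants are integers;
  division by zero yields 0.

  Since for \<open>d \<ge> 5\<close> eigenvalues are not obtained from the data by finitely many field operations,
  comparisons and radicals, there is one further instruction: \<open>LeastRoot r a n\<close> stores the least
  real root of the polynomial of degree at most \<open>n\<close> whose coefficients, constant term first,
  are in the registers \<open>a, \<dots>, a + n\<close>.\<close>

datatype prog =
    Skip
  | Const nat int
  | Add nat nat nat
  | Sub nat nat nat
  | Mul nat nat nat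
  | Div nat nat nat
  | Cnj nat nat
  | LeastRoot nat nat nat
  | Seq prog prog
  | IfPos nat prog prog

definition least_real_root :: "complex poly \<Rightarrow> real" where
  "least_real_root p =
     (let Z = {x :: real. poly p (of_real x) = 0} in if finite Z \<and> Z \<noteq> {} then Min Z else 0)"

primrec run :: "prog \<Rightarrow> (nat \<Rightarrow> complex) \<Rightarrow> (nat \<Rightarrow> complex)" where
  "run Skip s = s"
| "run (Const r k) s = s(r := of_int k)"
| "run (Add r a b) s = s(r := s a + s b)"
| "run (Sub r a b) s = s(r := s a - s b)"
| "run (Mul r a b) s = s(r := s a * s b)"
| "run (Div r a b) s = s(r := s a / s b)"
| "run (Cnj r a) s = s(r := cnj (s a))"
| "run (LeastRoot r a n) s = s(r := of_real (least_real_root (Poly (map s [a..<a + n + 1]))))"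
| "run (Seq P Q) s = run Q (run P s)"
| "run (IfPos a P Q) s = (if Re (s a) > 0 then run P s else run Q s)"

text \<open>Worst-case cost. Every instruction counts, including comparisons and the loading of
  constants. The root of a polynomial with \<open>n + 1\<close> coefficients is charged \<open>(n + 1)\<^sup>3\<close>, the
  price of the QR iteration on its companion matrix; a lower price would only weaken an upper
  bound on the cost.\<close>

primrec cost :: "prog \<Rightarrow> nat" where
  "cost Skip = 0"
| "cost (Const r k) = 1"
| "cost (Add r a b) = 1"
| "cost (Sub r a b) = 1"
| "cost (Mul r a b) = 1"
| "cost (Div r a b) = 1"
| "cost (Cnj r a) = 1"
| "cost (LeastRoot r a n) = (n + 1) ^ 3"
| "cost (Seq P Q) = cost P + cost Q"
| "cost (IfPos a P Q) = 1 + max (cost P) (cost Q)"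

definition mat_entries :: "complex mat \<Rightarrow> complex list" where
  "mat_entries A = concat (map list_of_vec (rows A))"

text \<open>Inputs and outputs occupy the registers \<open>0, 1, \<dots>\<close>; all other registers are initially 0.\<close>

definition load :: "complex list \<Rightarrow> nat \<Rightarrow> complex" where
  "load xs i = (if i < length xs then xs ! i else 0)"

definition computes :: "prog \<Rightarrow> complex list \<Rightarrow> complex list \<Rightarrow> bool" where
  "computes P xs ys \<longleftrightarrow> (\<forall>i<length ys. run P (load xs) i = ys ! i)"

text \<open>On input \<open>R, B\<^sub>1, \<dots>, B\<^sub>d\<close> the program forms the pencil, finds its smallest generalized
  eigenvalue with an eigenvector \<open>c\<close>, and assembles the matrix with coefficients \<open>c\<close>.\<close>

definition solves_pencil_problem :: "nat \<Rightarrow> complex mat \<Rightarrow> complex mat list \<Rightarrow> prog \<Rightarrow> bool" where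
  "solves_pencil_problem m R Bs P \<longleftrightarrow>
     (\<exists>l c. smallest_gen_eigenvalue (pencil_M R Bs) (pencil_G Bs) l \<and>
        gen_eigenvector (pencil_M R Bs) (pencil_G Bs) (of_real l) c \<and>
        computes P
          (mat_entries R @ concat (map mat_entries Bs))
          (mat_entries (pencil_M R Bs) @ mat_entries (pencil_G Bs) @ [of_real l] @
           list_of_vec c @ mat_entries (mat_lincomb m Bs c)))"

end

theory Submission
  imports Defs "HOL-Computational_Algebra.Polynomial_FPS"
begin

text \<open>For \<open>A = \<Sum>\<^sub>j c\<^sub>j B\<^sub>j\<close> the squared norms of \<open>[R, A]\<close> and of \<open>A\<close> are the values at \<open>c\<close> of the Hermitian
  forms of the pencil, the first positive semidefinite, the second positive definite. The infimum \<open>l\<close>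
  of the Rayleigh quotients makes \<open>K = M - l G\<close> positive semidefinite and degenerate, so \<open>l\<close> is the
  smallest generalized eigenvalue, and the quotient at \<open>c\<close> equals \<open>l\<close> iff \<open>c\<close> is null for \<open>K\<close>, that is,
  iff \<open>K c = 0\<close>.

  For the cost, Gram--Schmidt for \<open>G\<close> yields \<open>G\<^sup>-\<^sup>1\<close> and \<open>N = G\<^sup>-\<^sup>1 M\<close>, whose characteristic polynomial is
  obtained from the traces of its powers through Newton's identities (the method of Preparata and
  Sarwate). Its least real root is \<open>l\<close>, and Gram--Schmidt for the degenerate form \<open>K\<close> yields an
  eigenvector. Because \<open>d \<le> m\<^sup>2\<close> by linear independence, all steps cost \<open>O(d\<^sup>2 m\<^sup>3)\<close>, and no branching
  is needed.\<close>

section \<open>Positive semidefinite forms and Gram--Schmidt\<close>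

text \<open>One program must serve all data of a given size, while the rank of \<open>K\<close>, and
  hence the indices at which Gram--Schmidt meets a null vector, vary with the data. Totalised
  division absorbs these case distinctions, which is why \<open>gs\<close> is developed for
  degenerate forms from the outset. The same vectors replace compactness and the spectral theorem:
  that the infimum is attained only requires that a form with no zero among its values on them is
  coercive, and this is visible in their coordinates.

  The characteristic polynomial is the bottleneck. Newton's identities divide only by the integers
  1, ..., \<open>d\<close>, so no pivoting arises, but forming all powers of \<open>N\<close> in
  turn costs of order \<open>d^4\<close>, which for \<open>d\<close> close to \<open>m^2\<close>
  exceeds \<open>d^2 m^3\<close> by a factor of about \<open>m\<close>. Splitting the exponents
  reduces this to \<open>m d^3\<close>.

  The commutators of \<open>R\<close> with the \<open>B_j\<close> are formed once for each
  \<open>j\<close>; the entries of \<open>M\<close> are then inner products of them, so that no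
  double commutator is ever computed.\<close>

definition sform :: "nat \<Rightarrow> (nat \<Rightarrow> nat \<Rightarrow> complex) \<Rightarrow> (nat \<Rightarrow> complex) \<Rightarrow> (nat \<Rightarrow> complex) \<Rightarrow> complex" where
  "sform d H x y = (\<Sum>i<d. cnj (x i) * (\<Sum>j<d. H i j * y j))"

text \<open>Vectors are functions on \<open>nat\<close> of which only the entries below
  \<open>d\<close> count, so no carrier conditions arise. Taking the real part loses nothing, since
  Hermitian symmetry makes the value real.\<close>

definition psd :: "nat \<Rightarrow> (nat \<Rightarrow> nat \<Rightarrow> complex) \<Rightarrow> bool" where
  "psd d H \<longleftrightarrow> (\<forall>i<d. \<forall>j<d. H j i = cnj (H i j)) \<and> (\<forall>x. 0 \<le> Re (sform d H x x))"

lemma sform_cong: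
  "(\<And>i. i < d \<Longrightarrow> x i = x' i) \<Longrightarrow> (\<And>i. i < d \<Longrightarrow> y i = y' i) \<Longrightarrow> sform d H x y = sform d H x' y'"
  by (simp add: sform_def)

lemma sform_add_right: "sform d H x (\<lambda>i. y i + z i) = sform d H x y + sform d H x z"
  by (simp add: sform_def distrib_left sum.distrib)

lemma sform_add_left: "sform d H (\<lambda>i. y i + z i) x = sform d H y x + sform d H z x"
  by (simp add: sform_def distrib_right sum.distrib)

lemma sform_scale_right: "sform d H x (\<lambda>i. a * y i) = a * sform d H x y"
  by (simp add: sform_def sum_distrib_left mult.left_commute)

lemma sform_scale_left: "sform d H (\<lambda>i. a * x i) y = cnj a * sform d H x y"
  by (simp add: sform_def sum_distrib_left mult.assoc)

lemma sform_sum_right: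
  fixes n :: nat
  shows "sform d H x (\<lambda>i. \<Sum>k<n. a k * y k i) = (\<Sum>k<n. a k * sform d H x (y k))"
proof (induction n)
  case 0
  show ?case by (simp add: sform_def)
qed (simp add: sform_add_right sform_scale_right)

lemma sform_sum_left:
  fixes n :: nat
  shows "sform d H (\<lambda>i. \<Sum>k<n. a k * y k i) x = (\<Sum>k<n. cnj (a k) * sform d H (y k) x)"
proof (induction n)
  case 0
  show ?case by (simp add: sform_def)
qed (simp add: sform_add_left sform_scale_left)

lemma sform_diff_scaled:
  "sform d (\<lambda>i j. M i j - a * G i j) x y = sform d M x y - a * sform d G x y"
  by (simp add: sform_def sum_subtractf sum_distrib_left algebra_simps)

lemma sform_unit_left: "k < d \<Longrightarrow> sform d H (\<lambda>i. if i = k then 1 else 0) y = (\<Sum>j<d. H k j * y j)"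
proof -
  assume "k < d"
  have "sform d H (\<lambda>i. if i = k then 1 else 0) y = (\<Sum>i<d. if i = k then \<Sum>j<d. H i j * y j else 0)"
    unfolding sform_def by (rule sum.cong) auto
  then show ?thesis using \<open>k < d\<close> by simp
qed

lemma sform_unit_right: "k < d \<Longrightarrow> sform d H x (\<lambda>j. if j = k then 1 else 0) = (\<Sum>i<d. cnj (x i) * H i k)"
  by (simp add: sform_def if_distrib[of "(*) _"] cong: if_cong)

lemma sform_commute:
  assumes "psd d H"
  shows "sform d H y x = cnj (sform d H x y)"
proof -
  have "cnj (sform d H x y) = (\<Sum>i<d. \<Sum>j<d. x i * (cnj (H i j) * cnj (y j)))"
    by (simp add: sform_def sum_distrib_left)
  also have "\<dots> = (\<Sum>i<d. \<Sum>j<d. cnj (y j) * (H j i * x i))"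
  proof (intro sum.cong refl)
    fix i j assume "i \<in> {..<d}" "j \<in> {..<d}"
    then have "H j i = cnj (H i j)" using assms unfolding psd_def by blast
    then show "x i * (cnj (H i j) * cnj (y j)) = cnj (y j) * (H j i * x i)" by simp
  qed
  also have "\<dots> = (\<Sum>j<d. \<Sum>i<d. cnj (y j) * (H j i * x i))"
    by (rule sum.swap)
  finally show ?thesis by (simp add: sform_def sum_distrib_left)
qed

lemma psd_nonneg: "psd d H \<Longrightarrow> 0 \<le> Re (sform d H x x)"
  unfolding psd_def by blast

lemma sform_self_real: "psd d H \<Longrightarrow> sform d H x x = of_real (Re (sform d H x x))"
  using sform_commute[of d H x x] by (simp add: complex_eq_iff)

lemma sform_self_pos:
  assumes "psd d H" "sform d H x x \<noteq> 0"
  shows "Re (sform d H x x) > 0"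
proof -
  have "Re (sform d H x x) \<noteq> 0"
    using sform_self_real[OF assms(1), of x] assms(2) by (metis of_real_0)
  then show ?thesis using psd_nonneg[OF assms(1), of x] by simp
qed

text \<open>The degenerate case of the Cauchy--Schwarz inequality: if the product \<open>z\<close>
  with some \<open>y\<close> were nonzero, a small step from \<open>x\<close> in the direction
  \<open>- z * y\<close> would make the form negative, because the term linear in the step size
  beats the quadratic one.\<close>

lemma sform_null:
  assumes psd: "psd d H" and null: "sform d H x x = 0"
  shows "sform d H y x = 0"
proof (rule ccontr)
  define z where "z = sform d H y x"
  define Y where "Y = Re (sform d H y y)"
  assume "sform d H y x \<noteq> 0"
  then have z: "(cmod z)\<^sup>2 > 0" by (simp add: z_def)
  have Y: "Y \<ge> 0" "sform d H y y = of_real Y"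
    using psd_nonneg[OF psd] sform_self_real[OF psd] by (simp_all add: Y_def)
  \<comment> \<open>Any positive step size with \<open>e * Y < 2\<close> would do; the added 1 keeps
    the denominator positive when \<open>Y = 0\<close>.\<close>
  define e where "e = 1 / (Y + 1)"
  have e: "e > 0" "e * Y < 1" using Y by (auto simp: e_def field_simps)
  define s where "s = - of_real e * z"
  have "0 \<le> Re (sform d H (\<lambda>i. x i + s * y i) (\<lambda>i. x i + s * y i))"
    using psd by (rule psd_nonneg)
  also have "sform d H (\<lambda>i. x i + s * y i) (\<lambda>i. x i + s * y i) =
      s * cnj z + (cnj s * z + cnj s * (s * of_real Y))"
    using sform_commute[OF psd, of x y] null Y
    by (simp add: sform_add_left sform_add_right sform_scale_left sform_scale_right z_def algebra_simps)
  also have "\<dots> = (z * cnj z) * of_real (- 2 * e + e * e * Y)"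
    by (simp add: s_def algebra_simps)
  also have "\<dots> = of_real ((cmod z)\<^sup>2 * (- 2 * e + e * e * Y))"
    by (simp only: complex_norm_square of_real_mult)
  finally have "e * (2 - e * Y) * (cmod z)\<^sup>2 \<le> 0" by (simp add: algebra_simps)
  moreover have "e * (2 - e * Y) * (cmod z)\<^sup>2 > 0" using e z by (intro mult_pos_pos) auto
  ultimately show False by simp
qed

lemma sform_null_right:
  assumes "psd d H" "sform d H x x = 0"
  shows "sform d H x y = 0"
  using sform_null[OF assms, of y] sform_commute[OF assms(1), of x y] by simp

text \<open>Gram--Schmidt orthogonalisation of the unit vectors for a form that may be degenerate: when
  \<open>sform\<close> vanishes on \<open>gs d H k\<close>, the convention \<open>x / 0 = 0\<close> drops the term, as it should, since
  then \<open>gs d H k\<close> is in the radical of the form.\<close>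

function gs :: "nat \<Rightarrow> (nat \<Rightarrow> nat \<Rightarrow> complex) \<Rightarrow> nat \<Rightarrow> nat \<Rightarrow> complex" where
  "gs d H j = (\<lambda>i. (if i = j then 1 else 0) -
     (\<Sum>k<j. (\<Sum>l<d. cnj (gs d H k l) * H l j) / sform d H (gs d H k) (gs d H k) * gs d H k i))"
  by pat_completeness auto
termination by (relation "measure (\<lambda>(d, H, j). j)") auto

declare gs.simps [simp del]

lemma gs_above: "j < i \<Longrightarrow> gs d H j i = 0"
proof (induction j rule: less_induct)
  case (less j)
  then show ?case by (subst gs.simps) simp
qed

lemma gs_diag: "gs d H j j = 1"
  by (subst gs.simps) (simp add: gs_above)

lemma gs_orthogonal_less:
  assumes psd: "psd d H" and "j < d" "k < j"
  shows "sform d H (gs d H k) (gs d H j) = 0"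
  using assms(2,3)
proof (induction j arbitrary: k rule: less_induct)
  case (less j)
  let ?w = "gs d H"
  let ?e = "\<lambda>i. if i = j then 1 else 0 :: complex"
  let ?a = "\<lambda>l. sform d H (?w l) ?e / sform d H (?w l) (?w l)"
  have orth: "sform d H (?w k) (?w l) = 0" if "l < j" "l \<noteq> k" for l
  proof (cases "l < k")
    case True
    then show ?thesis using less sform_commute[OF psd, of "?w k" "?w l"] by auto
  next
    case False
    then show ?thesis using less that by auto
  qed
  have "?w j = (\<lambda>i. ?e i + (-1) * (\<Sum>l<j. ?a l * ?w l i))"
    using less.prems by (subst gs.simps) (simp add: sform_unit_right)
  then have "sform d H (?w k) (?w j) =
      sform d H (?w k) ?e + (-1) * (\<Sum>l<j. ?a l * sform d H (?w k) (?w l))"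
    by (simp only: sform_add_right sform_scale_right sform_sum_right)
  also have "(\<Sum>l<j. ?a l * sform d H (?w k) (?w l)) =
      (\<Sum>l<j. if l = k then ?a k * sform d H (?w k) (?w k) else 0)"
    by (rule sum.cong) (auto simp: orth)
  also have "\<dots> = ?a k * sform d H (?w k) (?w k)" using less.prems by simp
  \<comment> \<open>If the form vanishes on \<open>?w k\<close>, the quotient \<open>?a k\<close> is
    0 by convention and does not cancel the first term; but that term is then 0 as well, since
    \<open>?w k\<close> lies in the radical.\<close>
  finally show ?case
    using sform_null_right[OF psd, of "?w k" ?e] by (cases "sform d H (?w k) (?w k) = 0") auto
qed

lemma gs_orthogonal:
  assumes "psd d H" "j < d" "k < d" "j \<noteq> k"
  shows "sform d H (gs d H k) (gs d H j) = 0"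
  using assms gs_orthogonal_less[of d H] sform_commute[OF assms(1), of "gs d H k" "gs d H j"]
  by (cases "k < j") auto

text \<open>The vectors form a unit upper triangular matrix whatever \<open>H\<close> is, so the
  coefficients are found by removing the highest entry first, even for a degenerate form.\<close>

lemma gs_spanning:
  obtains y where "\<And>i. i < d \<Longrightarrow> x i = (\<Sum>j<d. y j * gs d H j i)"
proof -
  have "\<exists>y. \<forall>i. x i = (\<Sum>j<n. y j * gs d H j i)" if "\<forall>i\<ge>n. x i = 0" for n x
    using that
  proof (induction n arbitrary: x)
    case 0
    then show ?case by auto
  next
    case (Suc n)
    have "\<forall>i\<ge>n. x i - x n * gs d H n i = 0"
    proof (intro allI impI)
      fix i assume "n \<le> i"
      then show "x i - x n * gs d H n i = 0"
        using Suc.prems by (cases "i = n") (simp_all add: gs_diag gs_above)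
    qed
    from Suc.IH[OF this] obtain y where y: "\<forall>i. x i - x n * gs d H n i = (\<Sum>j<n. y j * gs d H j i)" ..
    have "x i = (\<Sum>j<Suc n. (y(n := x n)) j * gs d H j i)" for i
    proof -
      have "(\<Sum>j<n. (y(n := x n)) j * gs d H j i) = (\<Sum>j<n. y j * gs d H j i)"
        by (rule sum.cong) auto
      moreover have "x i = (\<Sum>j<n. y j * gs d H j i) + x n * gs d H n i"
        using spec[OF y, of i] by (simp only: diff_eq_eq)
      ultimately show ?thesis by simp
    qed
    then show ?case by blast
  qed
  from this[of d "\<lambda>i. if i < d then x i else 0"] obtain y
    where y: "\<forall>i. (if i < d then x i else 0) = (\<Sum>j<d. y j * gs d H j i)" by auto
  show ?thesis
  proof (rule that[of y])
    show "x i = (\<Sum>j<d. y j * gs d H j i)" if "i < d" for i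
      using spec[OF y, of i] that by simp
  qed
qed

lemma sform_gs_combination:
  assumes "psd d H" "k < d" and x: "\<And>i. i < d \<Longrightarrow> x i = (\<Sum>j<d. y j * gs d H j i)"
  shows "sform d H (gs d H k) x = y k * sform d H (gs d H k) (gs d H k)"
proof -
  have "sform d H (gs d H k) x = sform d H (gs d H k) (\<lambda>i. \<Sum>j<d. y j * gs d H j i)"
    by (rule sform_cong) (auto simp: x)
  also have "\<dots> = (\<Sum>j<d. y j * sform d H (gs d H k) (gs d H j))"
    by (rule sform_sum_right)
  also have "\<dots> = (\<Sum>j<d. if j = k then y k * sform d H (gs d H k) (gs d H k) else 0)"
    by (rule sum.cong) (use gs_orthogonal[OF assms(1)] assms(2) in auto)
  finally show ?thesis using assms(2) by simp
qed

lemma sform_diagonalized: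
  assumes "psd d H" and x: "\<And>i. i < d \<Longrightarrow> x i = (\<Sum>j<d. y j * gs d H j i)"
  shows "Re (sform d H x x) = (\<Sum>j<d. (cmod (y j))\<^sup>2 * Re (sform d H (gs d H j) (gs d H j)))"
proof -
  have "sform d H x x = sform d H (\<lambda>i. \<Sum>j<d. y j * gs d H j i) x"
    by (rule sform_cong) (auto simp: x)
  also have "\<dots> = (\<Sum>k<d. cnj (y k) * (y k * sform d H (gs d H k) (gs d H k)))"
    unfolding sform_sum_left by (intro sum.cong refl) (use sform_gs_combination[OF assms(1) _ x] in auto)
  also have "\<dots> = (\<Sum>k<d. of_real ((cmod (y k))\<^sup>2) * sform d H (gs d H k) (gs d H k))"
    by (simp only: complex_norm_square mult_ac)
  finally show ?thesis by simp
qed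

text \<open>In Gram--Schmidt coordinates \<open>y\<close> the form \<open>H\<close> is diagonal with
  positive entries, hence at least \<open>m\<close> times the squared length of \<open>y\<close>,
  while \<open>G\<close> is at most \<open>g\<close> times it, \<open>g\<close> being the sum of the
  absolute values of its entries. The quotient \<open>m / (g + 1)\<close> avoids a division by 0 if
  \<open>g = 0\<close>.\<close>

lemma coercive:
  assumes psd: "psd d H" and pos: "\<And>j. j < d \<Longrightarrow> sform d H (gs d H j) (gs d H j) \<noteq> 0"
  obtains e where "e > 0" "\<And>x. Re (sform d H x x) \<ge> e * Re (sform d G x x)"
proof -
  let ?w = "gs d H"
  let ?\<delta> = "\<lambda>j. Re (sform d H (?w j) (?w j))"
  have \<delta>: "?\<delta> j > 0" if "j < d" for j
    using psd pos[OF that] by (rule sform_self_pos)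
  obtain m where m: "m > 0" "\<And>j. j < d \<Longrightarrow> m \<le> ?\<delta> j"
  proof (cases "d = 0")
    case False
    let ?m = "Min (?\<delta> ` {..<d})"
    have "?m \<in> ?\<delta> ` {..<d}" using False by (intro Min_in) auto
    then have "?m > 0" using \<delta> by auto
    moreover have "?m \<le> ?\<delta> j" if "j < d" for j using that by (intro Min_le) auto
    ultimately show ?thesis by (rule that)
  qed (rule that[of 1], auto)
  define g where "g = (\<Sum>j<d. \<Sum>k<d. cmod (sform d G (?w j) (?w k)))"
  have g: "g \<ge> 0" unfolding g_def by (intro sum_nonneg) auto
  show ?thesis
  proof
    show "m / (g + 1) > 0" using m g by simp
    fix x
    obtain y where y: "\<And>i. i < d \<Longrightarrow> x i = (\<Sum>j<d. y j * ?w j i)" using gs_spanning by blast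
    define S where "S = (\<Sum>j<d. (cmod (y j))\<^sup>2)"
    have S: "S \<ge> 0" unfolding S_def by (intro sum_nonneg) auto
    have le: "(cmod (y j))\<^sup>2 \<le> S" if "j < d" for j
      unfolding S_def using that by (intro member_le_sum) auto
    have prod: "cmod (y j) * cmod (y k) \<le> S" if "j < d" "k < d" for j k
    proof -
      have "2 * (cmod (y j) * cmod (y k)) \<le> (cmod (y j))\<^sup>2 + (cmod (y k))\<^sup>2"
        using sum_squares_bound[of "cmod (y j)" "cmod (y k)"] by (simp add: mult.assoc)
      then show ?thesis using le[OF that(1)] le[OF that(2)] by simp
    qed
    have "sform d G x x = sform d G (\<lambda>i. \<Sum>j<d. y j * ?w j i) (\<lambda>i. \<Sum>j<d. y j * ?w j i)"
      by (rule sform_cong) (auto simp: y)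
    also have "\<dots> = (\<Sum>j<d. \<Sum>k<d. cnj (y j) * (y k * sform d G (?w j) (?w k)))"
      by (simp add: sform_sum_left sform_sum_right sum_distrib_left)
    finally have "Re (sform d G x x) \<le> cmod (\<Sum>j<d. \<Sum>k<d. cnj (y j) * (y k * sform d G (?w j) (?w k)))"
      by (simp only: complex_Re_le_cmod)
    also have "\<dots> \<le> (\<Sum>j<d. \<Sum>k<d. cmod (cnj (y j) * (y k * sform d G (?w j) (?w k))))"
      by (intro order_trans[OF norm_sum] sum_mono norm_sum)
    also have "\<dots> \<le> (\<Sum>j<d. \<Sum>k<d. S * cmod (sform d G (?w j) (?w k)))"
    proof (intro sum_mono)
      fix j k assume "j \<in> {..<d}" "k \<in> {..<d}"
      then have "cmod (y j) * cmod (y k) * cmod (sform d G (?w j) (?w k)) \<le> S * cmod (sform d G (?w j) (?w k))"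
        by (intro mult_right_mono prod) auto
      then show "cmod (cnj (y j) * (y k * sform d G (?w j) (?w k))) \<le> S * cmod (sform d G (?w j) (?w k))"
        by (simp add: norm_mult mult.assoc)
    qed
    also have "\<dots> = S * g" by (simp add: g_def sum_distrib_left)
    also have "\<dots> \<le> S * (g + 1)" using S by (intro mult_left_mono) auto
    finally have "m / (g + 1) * Re (sform d G x x) \<le> m / (g + 1) * (S * (g + 1))"
      using m g by (intro mult_left_mono) auto
    also have "\<dots> = S * m" using g by (simp add: field_simps)
    also have "\<dots> = (\<Sum>j<d. (cmod (y j))\<^sup>2 * m)"
      by (simp only: S_def sum_distrib_right)
    also have "\<dots> \<le> (\<Sum>j<d. (cmod (y j))\<^sup>2 * ?\<delta> j)"
      by (intro sum_mono mult_left_mono m(2)) auto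
    also have "\<dots> = Re (sform d H x x)" using sform_diagonalized[OF psd, of x y] y by simp
    finally show "m / (g + 1) * Re (sform d G x x) \<le> Re (sform d H x x)" .
  qed
qed

text \<open>With \<open>x / 0 = 0\<close> the factor below is 1 if the form vanishes on \<open>gs d H j\<close> and 0 otherwise.\<close>

definition null_vec :: "nat \<Rightarrow> (nat \<Rightarrow> nat \<Rightarrow> complex) \<Rightarrow> nat \<Rightarrow> complex" where
  "null_vec d H i = (\<Sum>j<d. (1 - sform d H (gs d H j) (gs d H j) / sform d H (gs d H j) (gs d H j)) * gs d H j i)"

text \<open>A basis vector on which the form vanishes lies in the radical by
  \<open>sform_null\<close>; every other one is removed by its factor 0.\<close>

lemma null_vec_null:
  assumes psd: "psd d H" and "i < d"
  shows "(\<Sum>j<d. H i j * null_vec d H j) = 0"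
proof -
  let ?e = "\<lambda>k. if k = i then 1 else 0 :: complex"
  have "(\<Sum>j<d. H i j * null_vec d H j) = sform d H ?e (null_vec d H)"
    using assms by (simp add: sform_unit_left)
  also have "\<dots> = 0"
    unfolding null_vec_def[abs_def] sform_sum_right
    by (rule sum.neutral) (use sform_null[OF psd] in auto)
  finally show ?thesis .
qed

text \<open>No cancellation can occur in the entry whose index is the largest \<open>k\<close> with
  vanishing form: by triangularity the other surviving vectors are 0 there, and
  \<open>gs d H k\<close> has the entry 1.\<close>

lemma null_vec_nonzero:
  assumes "j < d" "sform d H (gs d H j) (gs d H j) = 0"
  shows "\<exists>i<d. null_vec d H i \<noteq> 0"
proof -
  let ?\<delta> = "\<lambda>j. sform d H (gs d H j) (gs d H j)"
  let ?J = "{j. j < d \<and> ?\<delta> j = 0}"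
  define k where "k = Max ?J"
  have "k \<in> ?J" unfolding k_def using assms by (intro Max_in) auto
  have le: "j \<le> k" if "j < d" "?\<delta> j = 0" for j
    unfolding k_def using that by (intro Max_ge) auto
  have "null_vec d H k = (\<Sum>j<d. if j = k then 1 else 0)"
    unfolding null_vec_def
  proof (intro sum.cong refl)
    fix j assume "j \<in> {..<d}"
    then show "(1 - ?\<delta> j / ?\<delta> j) * gs d H j k = (if j = k then 1 else 0)"
      using le[of j] \<open>k \<in> ?J\<close> by (cases "?\<delta> j = 0") (auto simp: gs_diag gs_above)
  qed
  then show ?thesis using \<open>k \<in> ?J\<close> by (intro exI[of _ k]) auto
qed

section \<open>Rayleigh quotients and eigenvectors of a Hermitian pencil\<close>

definition pencil_eigvec :: "nat \<Rightarrow> (nat \<Rightarrow> nat \<Rightarrow> complex) \<Rightarrow> (nat \<Rightarrow> nat \<Rightarrow> complex) \<Rightarrow> complex \<Rightarrow> (nat \<Rightarrow> complex) \<Rightarrow> bool" where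
  "pencil_eigvec d M G l x \<longleftrightarrow> (\<exists>i<d. x i \<noteq> 0) \<and> (\<forall>i<d. (\<Sum>j<d. M i j * x j) = l * (\<Sum>j<d. G i j * x j))"

definition pd :: "nat \<Rightarrow> (nat \<Rightarrow> nat \<Rightarrow> complex) \<Rightarrow> bool" where
  "pd d G \<longleftrightarrow> psd d G \<and> (\<forall>x. (\<exists>i<d. x i \<noteq> 0) \<longrightarrow> sform d G x x \<noteq> 0)"

lemma pd_pos:
  assumes "pd d G" "\<exists>i<d. x i \<noteq> 0"
  shows "Re (sform d G x x) > 0"
proof -
  have "sform d G x x \<noteq> 0" "psd d G" using assms by (simp_all add: pd_def)
  then show ?thesis by (intro sform_self_pos)
qed

lemma pencil_eigvec_sform:
  assumes "pencil_eigvec d M G l x"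
  shows "sform d M y x = l * sform d G y x"
proof -
  have "sform d M y x = (\<Sum>i<d. cnj (y i) * (l * (\<Sum>j<d. G i j * x j)))"
    unfolding sform_def using assms by (intro sum.cong refl) (auto simp: pencil_eigvec_def)
  then show ?thesis by (simp add: sform_def sum_distrib_left mult_ac)
qed

lemma psd_shift:
  assumes "psd d M" "psd d G" "\<And>x. Re (sform d M x x) \<ge> l * Re (sform d G x x)"
  shows "psd d (\<lambda>i j. M i j - of_real l * G i j)"
  unfolding psd_def
proof (intro conjI allI impI)
  fix i j assume "i < d" "j < d"
  then have "M j i = cnj (M i j)" "G j i = cnj (G i j)"
    using assms(1,2) unfolding psd_def by blast+
  then show "M j i - of_real l * G j i = cnj (M i j - of_real l * G i j)" by simp
next
  fix x
  show "0 \<le> Re (sform d (\<lambda>i j. M i j - of_real l * G i j) x x)"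
    using assms(3)[of x] by (simp add: sform_diff_scaled)
qed

text \<open>The number \<open>l\<close> is the infimum of the Rayleigh quotients. If \<open>M - l G\<close> were nondegenerate, it
  would be coercive, and \<open>l\<close> could be increased.\<close>

theorem pencil_variational:
  assumes M: "psd d M" and G: "pd d G" and d: "d > 0"
  shows "\<exists>l. (\<forall>x. Re (sform d M x x) \<ge> l * Re (sform d G x x)) \<and>
    (\<exists>j<d. sform d (\<lambda>i j. M i j - of_real l * G i j) (gs d (\<lambda>i j. M i j - of_real l * G i j) j)
        (gs d (\<lambda>i j. M i j - of_real l * G i j) j) = 0)"
proof -
  let ?X = "{x :: nat \<Rightarrow> complex. \<exists>i<d. x i \<noteq> 0}" and ?q = "\<lambda>x. Re (sform d M x x) / Re (sform d G x x)"
  define l where "l = Inf (?q ` ?X)"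
  have "(\<lambda>_. 1) \<in> ?X" using d by auto
  then have ne: "?q ` ?X \<noteq> {}" by (simp only: image_is_empty) (rule notI, simp only: empty_iff)
  have q_nonneg: "0 \<le> ?q x" if "x \<in> ?X" for x
    using psd_nonneg[OF M, of x] pd_pos[OF G, of x] that by (intro divide_nonneg_pos) simp_all
  have bdd: "bdd_below (?q ` ?X)"
    using q_nonneg by (intro bdd_belowI2[of ?X 0 ?q])
  have ge: "Re (sform d M x x) \<ge> l * Re (sform d G x x)" for x
  proof (cases "x \<in> ?X")
    case True
    then have "l \<le> ?q x" unfolding l_def by (intro cInf_lower bdd imageI)
    then show ?thesis using pd_pos[OF G, of x] True by (simp add: pos_le_divide_eq)
  next
    case False
    then show ?thesis by (simp add: sform_def)
  qed
  let ?K = "\<lambda>i j. M i j - of_real l * G i j"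
  have K: "psd d ?K" using M G ge by (intro psd_shift) (auto simp: pd_def)
  have *: "\<exists>j<d. sform d ?K (gs d ?K j) (gs d ?K j) = 0"
  proof (rule ccontr)
    assume "\<not> ?thesis"
    then have nz: "sform d ?K (gs d ?K j) (gs d ?K j) \<noteq> 0" if "j < d" for j using that by simp
    obtain e where e: "e > 0" and *: "\<And>x. Re (sform d ?K x x) \<ge> e * Re (sform d G x x)"
      using coercive[OF K nz, of G] by metis
    have "l + e \<le> ?q x" if "x \<in> ?X" for x
    proof -
      have "Re (sform d M x x) \<ge> (l + e) * Re (sform d G x x)"
        using *[of x] by (simp add: sform_diff_scaled distrib_right)
      then show ?thesis using pd_pos[OF G, of x] that by (simp add: pos_le_divide_eq)
    qed
    then have "l + e \<le> Inf (?q ` ?X)" by (intro cINF_greatest) (use ne in simp_all)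
    then show False using e by (simp add: l_def)
  qed
  show ?thesis by (intro exI[of _ l] conjI allI ge *)
qed

text \<open>If \<open>W\<close> has the Gram--Schmidt vectors as columns, then
  \<open>W^H G W = D\<close> is diagonal, and this is the matrix
  \<open>W D^(-1) W^H\<close>.\<close>

definition pd_inverse :: "nat \<Rightarrow> (nat \<Rightarrow> nat \<Rightarrow> complex) \<Rightarrow> nat \<Rightarrow> nat \<Rightarrow> complex" where
  "pd_inverse d G i k =
     (\<Sum>j<d. gs d G j i * cnj (gs d G j k) / sform d G (gs d G j) (gs d G j))"

text \<open>Expand \<open>x\<close> in the Gram--Schmidt basis: the rank-one term belonging to a
  basis vector, applied to \<open>G x\<close>, returns exactly the component of \<open>x\<close>
  along that vector.\<close>

lemma pd_inverse_left:
  assumes G: "pd d G" and "i < d"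
  shows "(\<Sum>k<d. pd_inverse d G i k * (\<Sum>j<d. G k j * x j)) = x i"
proof -
  let ?w = "gs d G"
  have psd: "psd d G" using G by (simp add: pd_def)
  obtain y where y: "\<And>i. i < d \<Longrightarrow> x i = (\<Sum>j<d. y j * ?w j i)" using gs_spanning by blast
  have "(\<Sum>k<d. pd_inverse d G i k * (\<Sum>j<d. G k j * x j)) =
      (\<Sum>k<d. \<Sum>l<d. ?w l i * cnj (?w l k) / sform d G (?w l) (?w l) * (\<Sum>j<d. G k j * x j))"
    by (simp add: pd_inverse_def sum_distrib_right)
  also have "\<dots> = (\<Sum>l<d. \<Sum>k<d. ?w l i * cnj (?w l k) / sform d G (?w l) (?w l) * (\<Sum>j<d. G k j * x j))"
    by (rule sum.swap)
  also have "\<dots> = (\<Sum>l<d. ?w l i / sform d G (?w l) (?w l) * sform d G (?w l) x)"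
    unfolding sform_def[of _ _ _ x] by (simp add: sum_distrib_left mult_ac)
  also have "\<dots> = (\<Sum>l<d. y l * ?w l i)"
  proof (intro sum.cong refl)
    fix l assume "l \<in> {..<d}"
    then have l: "l < d" by simp
    moreover have "?w l l \<noteq> 0" by (simp add: gs_diag)
    ultimately have "sform d G (?w l) (?w l) \<noteq> 0" using G unfolding pd_def by blast
    with l show "?w l i / sform d G (?w l) (?w l) * sform d G (?w l) x = y l * ?w l i"
      by (simp add: sform_gs_combination[OF psd l y])
  qed
  finally show ?thesis using y[OF \<open>i < d\<close>] by simp
qed

section \<open>Newton identities for the characteristic polynomial\<close>

text \<open>Logarithmic differentiation of the product of the \<open>1 - a x\<close>.\<close>

lemma newton_identities_list:
  fixes as :: "complex list"
  defines "e \<equiv> \<lambda>k. coeff (\<Prod>a\<leftarrow>as. [:1, - a:]) k"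
  shows "of_nat (Suc k) * e (Suc k) = - (\<Sum>i\<le>k. e i * (\<Sum>a\<leftarrow>as. a ^ (Suc k - i)))"
proof -
  let ?P = "\<lambda>as :: complex list. fps_of_poly (\<Prod>a\<leftarrow>as. [:1, - a:])"
  let ?p = "\<lambda>as :: complex list. Abs_fps (\<lambda>k. \<Sum>a\<leftarrow>as. a ^ Suc k)"
  \<comment> \<open>The induction step in the abstract: \<open>l\<close> is the factor
    \<open>1 - a x\<close>, \<open>g\<close> the geometric series of \<open>a / (1 - a x)\<close>,
    so that \<open>l * g\<close> is the constant \<open>a\<close>, while \<open>p\<close> and
    \<open>q\<close> are the product and the power sums of the remaining list.\<close>
  have product_rule: "fps_deriv (l * p) = - (l * p * (g + q))"
    if "l * g = c" "fps_deriv l = - c" "fps_deriv p = - (p * q)" for l p g q c :: "complex fps"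
    by (simp add: that(2,3) that(1)[symmetric] algebra_simps)
  have "fps_deriv (?P as) = - (?P as * ?p as)"
  proof (induction as)
    case Nil
    have "?p [] = 0" by (simp add: fps_eq_iff)
    then show ?case by simp
  next
    case (Cons a as)
    let ?l = "fps_of_poly [:1, - a:]" and ?g = "Abs_fps (\<lambda>k. a ^ Suc k)"
    have l: "?l = 1 - fps_const a * fps_X"
      by (simp add: fps_of_poly_pCons)
    have 1: "?l * ?g = fps_const a"
    proof (rule fps_ext)
      fix n show "fps_nth (?l * ?g) n = fps_nth (fps_const a) n"
        by (cases n) (simp_all add: l left_diff_distrib mult.assoc)
    qed
    have 2: "fps_deriv ?l = - fps_const a" by (simp add: l)
    have "?p (a # as) = ?g + ?p as" by (simp add: fps_eq_iff)
    moreover have "?P (a # as) = ?l * ?P as" by (simp only: list.map prod_list.Cons fps_of_poly_mult)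
    ultimately show ?case
      using product_rule[OF 1 2 Cons.IH] by (simp only:)
  qed
  then have "fps_nth (fps_deriv (?P as)) k = fps_nth (- (?P as * ?p as)) k" by simp
  then have "of_nat (Suc k) * e (Suc k) = - (\<Sum>i=0..k. e i * (\<Sum>a\<leftarrow>as. a ^ Suc (k - i)))"
    by (simp add: e_def fps_mult_nth)
  also have "(\<Sum>i=0..k. e i * (\<Sum>a\<leftarrow>as. a ^ Suc (k - i))) = (\<Sum>i\<le>k. e i * (\<Sum>a\<leftarrow>as. a ^ (Suc k - i)))"
    by (intro sum.cong) (auto simp: atMost_atLeast0 Suc_diff_le)
  finally show ?thesis .
qed

text \<open>Reversing coefficients is multiplicative and turns each \<open>x - a\<close> into
  \<open>1 - a x\<close>, also for \<open>a = 0\<close>. This carries Newton's identities over to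
  the leading coefficients of a characteristic polynomial.\<close>

lemma coeff_linear_factors_reverse:
  fixes as :: "'a :: idom list"
  assumes "k \<le> length as"
  shows "coeff (\<Prod>a\<leftarrow>as. [:- a, 1:]) (length as - k) = coeff (\<Prod>a\<leftarrow>as. [:1, - a:]) k"
proof -
  have deg: "degree (\<Prod>a\<leftarrow>as. [:- a, 1:]) = length as"
    by (rule degree_linear_factors)
  have "reflect_poly [:- a, 1:] = [:1, - a:]" for a :: 'a
    by (cases "a = 0") (simp_all add: reflect_poly_def)
  then have "reflect_poly (\<Prod>a\<leftarrow>as. [:- a, 1:]) = (\<Prod>a\<leftarrow>as. [:1, - a:])"
    by (induction as) (simp_all add: reflect_poly_mult del: mult_pCons_left)
  then show ?thesis using coeff_reflect_poly[of "\<Prod>a\<leftarrow>as. [:- a, 1:]" k] assms by (simp add: deg)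
qed

section \<open>Traces of powers as power sums of the eigenvalues\<close>

lemma upper_triangular_mult_diag:
  assumes "A \<in> carrier_mat n n" "B \<in> carrier_mat n n" "upper_triangular A" "upper_triangular B" 
  shows "i < n \<Longrightarrow> j \<le> i \<Longrightarrow> (A * B) $$ (i, j) = (if i = j then A $$ (i, i) * B $$ (i, i) else 0 :: 'a :: semiring_0)"
proof -
  assume i: "i < n" and j: "j \<le> i"
  have "(A * B) $$ (i, j) = (\<Sum>k<n. A $$ (i, k) * B $$ (k, j))"
    using assms i j by (simp add: scalar_prod_def atLeast0LessThan)
  also have "\<dots> = (\<Sum>k<n. if k = i then (if i = j then A $$ (i, i) * B $$ (i, i) else 0) else 0)"
  proof (intro sum.cong refl)
    fix k assume "k \<in> {..<n}"
    then have "k < i \<Longrightarrow> A $$ (i, k) = 0" "k > j \<Longrightarrow> B $$ (k, j) = 0"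
      using assms i j by (auto dest!: upper_triangularD)
    then show "A $$ (i, k) * B $$ (k, j) = (if k = i then (if i = j then A $$ (i, i) * B $$ (i, i) else 0) else 0)"
      using j by (cases k i rule: linorder_cases) auto
  qed
  finally show ?thesis using i by simp
qed

lemma upper_triangular_pow_diag:
  fixes B :: "'a :: semiring_1 mat"
  assumes B: "B \<in> carrier_mat n n" "upper_triangular B"
  shows "upper_triangular (B ^\<^sub>m k) \<and> (\<forall>i<n. (B ^\<^sub>m k) $$ (i, i) = B $$ (i, i) ^ k)"
proof (induction k)
  case 0
  then show ?case using B by auto
next
  case (Suc k)
  have C: "B ^\<^sub>m k \<in> carrier_mat n n" using B by simp
  note * = upper_triangular_mult_diag[OF C B(1) _ B(2)]
  have "upper_triangular (B ^\<^sub>m Suc k)"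
    using * Suc B by (intro upper_triangularI) simp
  moreover have "(B ^\<^sub>m Suc k) $$ (i, i) = B $$ (i, i) ^ Suc k" if "i < n" for i
    using *[of i i] Suc that by (simp add: power_commutes)
  ultimately show ?case by blast
qed

lemma trace_mult_commute:
  assumes "A \<in> carrier_mat n m" "B \<in> carrier_mat m n"
  shows "mat_trace (A * B) = mat_trace (B * A)"
proof -
  have "mat_trace (A * B) = (\<Sum>i<n. \<Sum>k<m. A $$ (i, k) * B $$ (k, i))"
    using assms by (simp add: mat_trace_def scalar_prod_def atLeast0LessThan)
  also have "\<dots> = (\<Sum>k<m. \<Sum>i<n. B $$ (k, i) * A $$ (i, k))"
    by (subst sum.swap) (simp add: mult.commute)
  also have "\<dots> = mat_trace (B * A)"
    using assms by (simp add: mat_trace_def scalar_prod_def atLeast0LessThan)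
  finally show ?thesis .
qed

text \<open>A Schur decomposition makes \<open>A\<close> similar to a triangular matrix with
  diagonal \<open>as\<close>; powers of that matrix have the powers of the eigenvalues on the
  diagonal, and the trace is invariant under similarity.\<close>

lemma trace_pow_eigenvalues:
  assumes A: "A \<in> carrier_mat n n" and cp: "char_poly A = (\<Prod>a\<leftarrow>as. [:- a, 1:])"
  shows "mat_trace (A ^\<^sub>m k) = (\<Sum>a\<leftarrow>as. a ^ k)"
proof -
  obtain B P Q where "schur_decomposition A as = (B, P, Q)" by (metis prod_cases3)
  from schur_decomposition[OF A cp this] have
    sim: "similar_mat_wit A B P Q" and up: "upper_triangular B" and diag: "diag_mat B = as" by auto
  note carr = similar_mat_witD2[OF A sim]
  have B: "B \<in> carrier_mat n n" and P: "P \<in> carrier_mat n n" and Q: "Q \<in> carrier_mat n n"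
    and QP: "Q * P = 1\<^sub>m n" using carr by auto
  have Bk: "B ^\<^sub>m k \<in> carrier_mat n n" using B by simp
  have "mat_trace (A ^\<^sub>m k) = mat_trace (P * (B ^\<^sub>m k * Q))"
    using similar_mat_wit_pow_id[OF sim] Bk P Q by (simp add: assoc_mult_mat)
  also have "\<dots> = mat_trace (B ^\<^sub>m k * Q * P)"
    using Bk P Q by (intro trace_mult_commute) auto
  also have "B ^\<^sub>m k * Q * P = B ^\<^sub>m k"
    using Bk P Q QP by (simp add: assoc_mult_mat right_mult_one_mat[OF Bk])
  also have "mat_trace (B ^\<^sub>m k) = (\<Sum>i<n. B $$ (i, i) ^ k)"
    using upper_triangular_pow_diag[OF B up, of k] Bk by (auto simp: mat_trace_def)
  also have "\<dots> = (\<Sum>a\<leftarrow>as. a ^ k)"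
    using B by (simp add: diag[symmetric] diag_mat_def interv_sum_list_conv_sum_set_nat atLeast0LessThan o_def)
  finally show ?thesis .
qed

text \<open>The range \<open>k < n\<close> matters: beyond it, truncated subtraction in
  \<open>n - k\<close> would return the constant coefficient instead of 0.\<close>

theorem newton_identities_char_poly:
  fixes A :: "complex mat"
  assumes A: "A \<in> carrier_mat n n" and "k < n"
  defines "e \<equiv> \<lambda>k. coeff (char_poly A) (n - k)"
  shows "of_nat (Suc k) * e (Suc k) = - (\<Sum>i\<le>k. e i * mat_trace (A ^\<^sub>m (Suc k - i)))"
proof -
  obtain as where cp: "char_poly A = (\<Prod>a\<leftarrow>as. [:- a, 1:])" and len: "length as = n"
    using char_poly_factorized[OF A] by auto
  have e: "e i = coeff (\<Prod>a\<leftarrow>as. [:1, - a:]) i" if "i \<le> n" for i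
    using coeff_linear_factors_reverse[of i as] that by (simp add: e_def cp len)
  have "of_nat (Suc k) * e (Suc k) = - (\<Sum>i\<le>k. coeff (\<Prod>a\<leftarrow>as. [:1, - a:]) i * (\<Sum>a\<leftarrow>as. a ^ (Suc k - i)))"
    using e[of "Suc k"] \<open>k < n\<close> newton_identities_list[of k as] by simp
  also have "\<dots> = - (\<Sum>i\<le>k. e i * mat_trace (A ^\<^sub>m (Suc k - i)))"
    using e \<open>k < n\<close> trace_pow_eigenvalues[OF A cp] by simp
  finally show ?thesis .
qed

section \<open>The pencil\<close>

lemma mat_adjoint_dims [simp]: "dim_row (mat_adjoint A) = dim_col A" "dim_col (mat_adjoint A) = dim_row A"
  by (simp_all add: mat_adjoint_def)

lemma mat_adjoint_index [simp]:
  "i < dim_col A \<Longrightarrow> j < dim_row A \<Longrightarrow> mat_adjoint (A :: complex mat) $$ (i, j) = cnj (A $$ (j, i))"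
  unfolding mat_adjoint_def by (simp add: mat_of_rows_index)

lemma mat_adjoint_carrier [simp]: "A \<in> carrier_mat n m \<Longrightarrow> mat_adjoint A \<in> carrier_mat m n"
  by (intro carrier_matI) simp_all

lemma mult_mat_index:
  "A \<in> carrier_mat n k \<Longrightarrow> B \<in> carrier_mat k m \<Longrightarrow> i < n \<Longrightarrow> j < m \<Longrightarrow>
    (A * B) $$ (i, j) = (\<Sum>l<k. A $$ (i, l) * B $$ (l, j))"
  by (simp add: scalar_prod_def atLeast0LessThan)

lemma mat_adjoint_mult:
  fixes A B :: "complex mat"
  assumes "A \<in> carrier_mat n k" "B \<in> carrier_mat k m"
  shows "mat_adjoint (A * B) = mat_adjoint B * mat_adjoint A"
proof (rule eq_matI)
  fix i j assume "i < dim_row (mat_adjoint B * mat_adjoint A)" "j < dim_col (mat_adjoint B * mat_adjoint A)"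
  then have ij: "i < m" "j < n" using assms by auto
  have "mat_adjoint (A * B) $$ (i, j) = cnj ((A * B) $$ (j, i))" using assms ij by simp
  also have "\<dots> = (\<Sum>l<k. mat_adjoint B $$ (i, l) * mat_adjoint A $$ (l, j))"
    using assms ij by (simp add: mult_mat_index[OF assms] mult.commute del: index_mult_mat)
  also have "\<dots> = (mat_adjoint B * mat_adjoint A) $$ (i, j)"
    using assms ij by (subst mult_mat_index[of _ m k _ n]) simp_all
  finally show "mat_adjoint (A * B) $$ (i, j) = (mat_adjoint B * mat_adjoint A) $$ (i, j)" .
qed (use assms in auto)

lemma mat_adjoint_minus:
  fixes A B :: "complex mat"
  assumes "A \<in> carrier_mat n m" "B \<in> carrier_mat n m"
  shows "mat_adjoint (A - B) = mat_adjoint A - mat_adjoint B"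
  by (rule eq_matI) (use assms in auto)

lemma mat_trace_minus:
  assumes "A \<in> carrier_mat n n" "B \<in> carrier_mat n n"
  shows "mat_trace (A - B) = mat_trace A - mat_trace B"
  using assms by (simp add: mat_trace_def sum_subtractf)

lemma commutator_carrier [simp]:
  "R \<in> carrier_mat m m \<Longrightarrow> X \<in> carrier_mat m m \<Longrightarrow> commutator R X \<in> carrier_mat m m"
  unfolding commutator_def by (intro minus_carrier_mat mult_carrier_mat)

lemma commutator_index:
  assumes "R \<in> carrier_mat m m" "X \<in> carrier_mat m m" "i < m" "k < m"
  shows "commutator R X $$ (i, k) = (\<Sum>p<m. R $$ (i, p) * X $$ (p, k)) - (\<Sum>p<m. X $$ (i, p) * R $$ (p, k))"
  using assms by (simp add: commutator_def mult_mat_index[of _ m m _ m] del: index_mult_mat(1))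

text \<open>The map \<open>commutator R\<close> is self-adjoint for the trace inner product, because
  \<open>R\<close> is Hermitian and the trace is cyclic. So \<open>M\<close> is the Gram matrix of
  the commutators with \<open>R\<close>: it is positive semidefinite, and \<open>d\<close>
  commutators suffice to compute it.\<close>

lemma trace_adjoint_ad2:
  assumes R: "R \<in> carrier_mat m m" "hermitian_mat R" and "X \<in> carrier_mat m m" "Y \<in> carrier_mat m m"
  shows "mat_trace (mat_adjoint X * ad2 R Y) = mat_trace (mat_adjoint (commutator R X) * commutator R Y)"
proof -
  define Z where "Z = commutator R Y"
  have Z: "Z \<in> carrier_mat m m" and X: "mat_adjoint X \<in> carrier_mat m m"
    using assms by (simp_all add: Z_def)
  have adj: "mat_adjoint (commutator R X) = mat_adjoint X * R - R * mat_adjoint X"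
    using assms by (simp add: commutator_def mat_adjoint_minus[of _ m m] mat_adjoint_mult[of _ m m _ m] hermitian_mat_def)
  have ad2: "ad2 R Y = R * Z - Z * R" by (simp add: ad2_def Z_def commutator_def)
  have "mat_trace (mat_adjoint X * ad2 R Y) = mat_trace (mat_adjoint X * (R * Z) - mat_adjoint X * (Z * R))"
    using R(1) X Z by (simp add: ad2 mult_minus_distrib_mat[of _ m m _ m])
  also have "\<dots> = mat_trace (mat_adjoint X * R * Z) - mat_trace (mat_adjoint X * Z * R)"
    using R(1) X Z by (simp add: mat_trace_minus[of _ m] assoc_mult_mat[of _ m m _ m _ m])
  also have "mat_trace (mat_adjoint X * Z * R) = mat_trace (R * (mat_adjoint X * Z))"
    using R(1) X Z by (intro trace_mult_commute) auto
  also have "mat_trace (mat_adjoint X * R * Z) - mat_trace (R * (mat_adjoint X * Z)) =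
      mat_trace ((mat_adjoint X * R - R * mat_adjoint X) * Z)"
    using R(1) X Z
    by (simp add: minus_mult_distrib_mat[of _ m m] mat_trace_minus[of _ m] assoc_mult_mat[of _ m m _ m _ m])
  finally show ?thesis by (simp add: adj Z_def)
qed

section \<open>Frobenius inner product and Gram matrices\<close>

definition frob_inner :: "nat \<Rightarrow> complex mat \<Rightarrow> complex mat \<Rightarrow> complex" where
  "frob_inner m X Y = (\<Sum>k<m. \<Sum>l<m. cnj (X $$ (k, l)) * Y $$ (k, l))"

lemma trace_adjoint_mult:
  assumes "X \<in> carrier_mat m m" "Y \<in> carrier_mat m m"
  shows "mat_trace (mat_adjoint X * Y) = frob_inner m X Y"
proof -
  have "mat_trace (mat_adjoint X * Y) = (\<Sum>l<m. \<Sum>k<m. cnj (X $$ (k, l)) * Y $$ (k, l))"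
    using assms by (simp add: mat_trace_def mult_mat_index[of _ m m _ m] del: index_mult_mat(1))
  also have "\<dots> = frob_inner m X Y" unfolding frob_inner_def by (rule sum.swap)
  finally show ?thesis .
qed

lemma frob_inner_commute: "frob_inner m Y X = cnj (frob_inner m X Y)"
  by (simp add: frob_inner_def mult.commute)

lemma frob_inner_self: "frob_inner m X X = of_real (\<Sum>k<m. \<Sum>l<m. (cmod (X $$ (k, l)))\<^sup>2)"
proof -
  have "cnj z * z = of_real ((cmod z)\<^sup>2)" for z
    by (simp only: complex_norm_square mult.commute)
  then show ?thesis by (simp add: frob_inner_def)
qed

lemma frobenius_norm_square:
  assumes "X \<in> carrier_mat m m"
  shows "(frobenius_norm X)\<^sup>2 = Re (frob_inner m X X)"
proof -
  have "0 \<le> Re (frob_inner m X X)" by (simp add: frob_inner_self sum_nonneg)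
  then show ?thesis by (simp add: frobenius_norm_def trace_adjoint_mult[OF assms assms])
qed

text \<open>Indexed by a function instead of a list, so that the same facts serve both the given
  matrices and their commutators with \<open>R\<close>.\<close>

definition lincomb :: "nat \<Rightarrow> nat \<Rightarrow> (nat \<Rightarrow> complex mat) \<Rightarrow> (nat \<Rightarrow> complex) \<Rightarrow> complex mat" where
  "lincomb m d F c = mat m m (\<lambda>(i, k). \<Sum>j<d. c j * F j $$ (i, k))"

lemma lincomb_carrier [simp]: "lincomb m d F c \<in> carrier_mat m m"
  by (simp add: lincomb_def)

lemma mat_lincomb_eq: "mat_lincomb m Bs c = lincomb m (length Bs) ((!) Bs) (($) c)"
  by (simp add: mat_lincomb_def lincomb_def)

lemma commutator_lincomb:
  assumes R: "R \<in> carrier_mat m m" and F: "\<And>j. j < d \<Longrightarrow> F j \<in> carrier_mat m m"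
  shows "commutator R (lincomb m d F c) = lincomb m d (\<lambda>j. commutator R (F j)) c"
proof (rule eq_matI)
  fix i k assume "i < dim_row (lincomb m d (\<lambda>j. commutator R (F j)) c)"
    "k < dim_col (lincomb m d (\<lambda>j. commutator R (F j)) c)"
  then have ik: "i < m" "k < m" by (simp_all add: lincomb_def)
  have "commutator R (lincomb m d F c) $$ (i, k) =
      (\<Sum>p<m. R $$ (i, p) * (\<Sum>j<d. c j * F j $$ (p, k))) - (\<Sum>p<m. (\<Sum>j<d. c j * F j $$ (i, p)) * R $$ (p, k))"
    unfolding commutator_index[OF R lincomb_carrier ik] using ik by (simp add: lincomb_def)
  also have "(\<Sum>p<m. R $$ (i, p) * (\<Sum>j<d. c j * F j $$ (p, k))) = (\<Sum>j<d. c j * (\<Sum>p<m. R $$ (i, p) * F j $$ (p, k)))"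
    unfolding sum_distrib_left by (subst sum.swap) (simp add: mult.left_commute)
  also have "(\<Sum>p<m. (\<Sum>j<d. c j * F j $$ (i, p)) * R $$ (p, k)) = (\<Sum>j<d. c j * (\<Sum>p<m. F j $$ (i, p) * R $$ (p, k)))"
    unfolding sum_distrib_left sum_distrib_right by (subst sum.swap) (simp add: mult.assoc)
  also have "(\<Sum>j<d. c j * (\<Sum>p<m. R $$ (i, p) * F j $$ (p, k))) - (\<Sum>j<d. c j * (\<Sum>p<m. F j $$ (i, p) * R $$ (p, k))) =
      (\<Sum>j<d. c j * commutator R (F j) $$ (i, k))"
    by (simp add: commutator_index[OF R F ik] right_diff_distrib sum_subtractf)
  finally show "commutator R (lincomb m d F c) $$ (i, k) = lincomb m d (\<lambda>j. commutator R (F j)) c $$ (i, k)"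
    using ik by (simp add: lincomb_def)
qed (use R in \<open>simp_all add: lincomb_def commutator_def\<close>)

lemma frob_inner_lincomb_right:
  "frob_inner m X (lincomb m d F c) = (\<Sum>j<d. c j * frob_inner m X (F j))"
proof -
  have "frob_inner m X (lincomb m d F c) = (\<Sum>k<m. \<Sum>l<m. \<Sum>j<d. c j * (cnj (X $$ (k, l)) * F j $$ (k, l)))"
    by (simp add: frob_inner_def lincomb_def sum_distrib_left mult.left_commute)
  also have "\<dots> = (\<Sum>k<m. \<Sum>j<d. \<Sum>l<m. c j * (cnj (X $$ (k, l)) * F j $$ (k, l)))"
    by (intro sum.cong[OF refl] sum.swap)
  also have "\<dots> = (\<Sum>j<d. \<Sum>k<m. \<Sum>l<m. c j * (cnj (X $$ (k, l)) * F j $$ (k, l)))"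
    by (rule sum.swap)
  finally show ?thesis by (simp add: frob_inner_def sum_distrib_left)
qed

lemma frob_inner_lincomb:
  "frob_inner m (lincomb m d F c) (lincomb m d F c) = sform d (\<lambda>i j. frob_inner m (F i) (F j)) c c"
proof -
  have "frob_inner m (lincomb m d F c) Y = (\<Sum>i<d. cnj (c i) * frob_inner m (F i) Y)" for Y
    unfolding frob_inner_commute[of m "lincomb m d F c" Y] frob_inner_lincomb_right
  proof -
    have "cnj (\<Sum>j<d. c j * frob_inner m Y (F j)) = (\<Sum>j<d. cnj (c j) * cnj (frob_inner m Y (F j)))" by simp
    also have "\<dots> = (\<Sum>j<d. cnj (c j) * frob_inner m (F j) Y)"
      by (intro sum.cong refl) (simp only: frob_inner_commute[of m "F _" Y])
    finally show "cnj (\<Sum>j<d. c j * frob_inner m Y (F j)) = (\<Sum>i<d. cnj (c i) * frob_inner m (F i) Y)" .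
  qed
  from this[of "lincomb m d F c"] show ?thesis
    by (simp add: sform_def frob_inner_lincomb_right mult.commute)
qed

lemma psd_cong:
  assumes "\<And>i j. i < d \<Longrightarrow> j < d \<Longrightarrow> H i j = H' i j" "psd d H'"
  shows "psd d H"
  unfolding psd_def
proof (intro conjI allI impI)
  fix i j assume "i < d" "j < d"
  moreover from this have "H' j i = cnj (H' i j)" using assms(2) unfolding psd_def by blast
  ultimately show "H j i = cnj (H i j)" by (simp only: assms(1))
next
  fix x
  have "sform d H x x = sform d H' x x" by (simp add: sform_def assms(1))
  then show "0 \<le> Re (sform d H x x)" using psd_nonneg[OF assms(2)] by simp
qed

text \<open>The value of the form at \<open>x\<close> is the squared norm of the combination with
  coefficients \<open>x\<close>.\<close>

lemma psd_gram: "psd d (\<lambda>i j. frob_inner m (F i) (F j))"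
  unfolding psd_def frob_inner_lincomb[symmetric]
proof (intro conjI allI impI)
  show "frob_inner m (F j) (F i) = cnj (frob_inner m (F i) (F j))" for i j
    by (rule frob_inner_commute)
  show "0 \<le> Re (frob_inner m (lincomb m d F x) (lincomb m d F x))" for x
    by (simp add: frob_inner_self sum_nonneg)
qed

section \<open>The pencil of fixed data\<close>

locale pencil_problem =
  fixes d m :: nat and R :: "complex mat" and Bs :: "complex mat list"
  assumes data: "problem_data d m R Bs"
begin

lemma d_pos: "0 < d" and R: "R \<in> carrier_mat m m" "hermitian_mat R" and length_Bs: "length Bs = d"
  and indep: "mat_lin_indep m Bs"
  using data by (simp_all add: problem_data_def)

lemma Bs: "j < d \<Longrightarrow> Bs ! j \<in> carrier_mat m m"
  using data by (auto simp: problem_data_def)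

abbreviation M :: "nat \<Rightarrow> nat \<Rightarrow> complex" where "M i j \<equiv> pencil_M R Bs $$ (i, j)"
abbreviation G :: "nat \<Rightarrow> nat \<Rightarrow> complex" where "G i j \<equiv> pencil_G Bs $$ (i, j)"

lemma pencil_carrier: "pencil_M R Bs \<in> carrier_mat d d" "pencil_G Bs \<in> carrier_mat d d"
  by (simp_all add: pencil_M_def pencil_G_def length_Bs)

lemma G_eq: "i < d \<Longrightarrow> j < d \<Longrightarrow> G i j = frob_inner m (Bs ! i) (Bs ! j)"
  by (simp add: pencil_G_def length_Bs trace_adjoint_mult[OF Bs Bs])

lemma M_eq: "i < d \<Longrightarrow> j < d \<Longrightarrow> M i j = frob_inner m (commutator R (Bs ! i)) (commutator R (Bs ! j))"
  using trace_adjoint_ad2[OF R Bs Bs, of i j]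
  by (simp add: pencil_M_def length_Bs trace_adjoint_mult[of _ m] Bs R)

lemma sform_G: "sform d G c c = frob_inner m (lincomb m d ((!) Bs) c) (lincomb m d ((!) Bs) c)"
  unfolding frob_inner_lincomb by (simp add: sform_def G_eq)

lemma sform_M: "sform d M c c =
    frob_inner m (commutator R (lincomb m d ((!) Bs) c)) (commutator R (lincomb m d ((!) Bs) c))"
proof -
  have *: "commutator R (lincomb m d ((!) Bs) c) = lincomb m d (\<lambda>j. commutator R (Bs ! j)) c"
    by (rule commutator_lincomb[OF R(1) Bs])
  show ?thesis unfolding * frob_inner_lincomb by (simp add: sform_def M_eq)
qed

lemma quotient_eq: "commutator_quotient R (lincomb m d ((!) Bs) c) = Re (sform d M c c) / Re (sform d G c c)"
  by (simp add: commutator_quotient_def sform_M sform_G frobenius_norm_square[of _ m] R)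

lemma psd_M: "psd d M" and psd_G: "psd d G"
proof -
  show "psd d M"
    by (rule psd_cong[OF M_eq psd_gram])
  show "psd d G"
    by (rule psd_cong[OF G_eq psd_gram])
qed

lemma lincomb_vec: "lincomb m d ((!) Bs) c = mat_lincomb m Bs (vec d c)"
  by (simp add: mat_lincomb_eq length_Bs lincomb_def)

lemma lincomb_eq_0: 
  assumes "lincomb m d ((!) Bs) c = 0\<^sub>m m m" "i < d"
  shows "c i = 0"
proof -
  have "vec d c = 0\<^sub>v d"
    using indep assms(1) unfolding mat_lin_indep_def lincomb_vec length_Bs by (meson vec_carrier)
  then show ?thesis using assms(2) by (metis index_vec index_zero_vec(1))
qed

text \<open>A vanishing value means that the linear combination has norm 0, hence is the zero
  matrix, and linear independence applies.\<close>

lemma pd_G: "pd d G"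
  unfolding pd_def
proof (intro conjI allI impI psd_G notI)
  fix c assume nz: "\<exists>i<d. c i \<noteq> 0" and "sform d G c c = 0"
  let ?A = "lincomb m d ((!) Bs) c"
  have "(\<Sum>k<m. \<Sum>l<m. (cmod (?A $$ (k, l)))\<^sup>2) = 0"
    using \<open>sform d G c c = 0\<close> unfolding sform_G frob_inner_self by (simp only: of_real_eq_0_iff)
  then have "?A $$ (k, l) = 0" if "k < m" "l < m" for k l
    using that by (simp add: sum_nonneg_eq_0_iff sum_nonneg)
  then have "?A = 0\<^sub>m m m" by (intro eq_matI) (simp_all add: lincomb_def)
  with nz lincomb_eq_0 show False by blast
qed

lemma gen_eigenvector_iff:
  "gen_eigenvector (pencil_M R Bs) (pencil_G Bs) \<mu> c \<longleftrightarrow>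
     c \<in> carrier_vec d \<and> pencil_eigvec d M G \<mu> (($) c)"
proof (cases "c \<in> carrier_vec d")
  case True
  have 1: "c \<noteq> 0\<^sub>v d \<longleftrightarrow> (\<exists>i<d. c $ i \<noteq> 0)"
    using True by (auto simp: vec_eq_iff)
  have "pencil_M R Bs *\<^sub>v c = \<mu> \<cdot>\<^sub>v (pencil_G Bs *\<^sub>v c) \<longleftrightarrow>
      (\<forall>i<d. (\<Sum>j<d. M i j * c $ j) = \<mu> * (\<Sum>j<d. G i j * c $ j))"
    using True pencil_carrier by (simp add: vec_eq_iff scalar_prod_def atLeast0LessThan)
  with 1 True pencil_carrier show ?thesis
    unfolding gen_eigenvector_def pencil_eigvec_def by auto
next
  case False
  then show ?thesis using pencil_carrier by (simp add: gen_eigenvector_def)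
qed

text \<open>The two conditions say that \<open>l\<close> bounds the Rayleigh quotients from below
  and that the bound is attained. The choice operator turns the eigenvalue into a function of the
  data, which is needed to treat it as a value computed from the input.\<close>

definition l_min :: real where
  "l_min = (SOME l. (\<forall>x. Re (sform d M x x) \<ge> l * Re (sform d G x x)) \<and>
     (\<exists>j<d. sform d (\<lambda>i j. M i j - of_real l * G i j) (gs d (\<lambda>i j. M i j - of_real l * G i j) j)
        (gs d (\<lambda>i j. M i j - of_real l * G i j) j) = 0))"

abbreviation K :: "nat \<Rightarrow> nat \<Rightarrow> complex" where "K i j \<equiv> M i j - of_real l_min * G i j"

lemma l_min: "Re (sform d M x x) \<ge> l_min * Re (sform d G x x)"
  and K_degenerate: "\<exists>j<d. sform d K (gs d K j) (gs d K j) = 0"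
proof -
  have "\<exists>l. (\<forall>x. Re (sform d M x x) \<ge> l * Re (sform d G x x)) \<and>
     (\<exists>j<d. sform d (\<lambda>i j. M i j - of_real l * G i j) (gs d (\<lambda>i j. M i j - of_real l * G i j) j)
        (gs d (\<lambda>i j. M i j - of_real l * G i j) j) = 0)"
    by (rule pencil_variational[OF psd_M pd_G d_pos])
  from someI_ex[OF this] show "Re (sform d M x x) \<ge> l_min * Re (sform d G x x)"
    "\<exists>j<d. sform d K (gs d K j) (gs d K j) = 0"
    unfolding l_min_def[symmetric] by (rule conjunct1[THEN spec], rule conjunct2)
qed

lemma psd_K: "psd d K"
  using psd_M psd_G l_min by (rule psd_shift)

lemma pencil_eigvec_iff_K:
  "pencil_eigvec d M G (of_real l_min) x \<longleftrightarrow> (\<exists>i<d. x i \<noteq> 0) \<and> (\<forall>i<d. (\<Sum>j<d. K i j * x j) = 0)"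
  by (simp add: pencil_eigvec_def left_diff_distrib sum_subtractf sum_distrib_left mult.assoc)

lemma null_vec_eigvec: "gen_eigenvector (pencil_M R Bs) (pencil_G Bs) (of_real l_min) (vec d (null_vec d K))"
proof -
  have "pencil_eigvec d M G (of_real l_min) (null_vec d K)"
    unfolding pencil_eigvec_iff_K
    using null_vec_nonzero[of _ d K] K_degenerate null_vec_null[OF psd_K] by blast
  then have "pencil_eigvec d M G (of_real l_min) (($) (vec d (null_vec d K)))"
    by (auto simp: pencil_eigvec_def)
  then show ?thesis by (simp add: gen_eigenvector_iff)
qed

lemma eigvec_iff_quotient:
  assumes "\<exists>i<d. x i \<noteq> 0"
  shows "pencil_eigvec d M G (of_real l_min) x \<longleftrightarrow> Re (sform d M x x) / Re (sform d G x x) = l_min"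
proof -
  have pos: "Re (sform d G x x) > 0" using pd_G assms by (rule pd_pos)
  have "pencil_eigvec d M G (of_real l_min) x \<longleftrightarrow> sform d K x x = 0"
  proof
    assume "pencil_eigvec d M G (of_real l_min) x"
    then show "sform d K x x = 0" by (simp add: pencil_eigvec_iff_K sform_def)
  next
    assume "sform d K x x = 0"
    \<comment> \<open>A null vector of a positive semidefinite form lies in its radical; pairing
      with the unit vectors gives the entries of \<open>K x\<close>.\<close>
    then have "(\<Sum>j<d. K i j * x j) = 0" if "i < d" for i
      using sform_null[OF psd_K, of x "\<lambda>k. if k = i then 1 else 0"] sform_unit_left[OF that, of K x] by simp
    then show "pencil_eigvec d M G (of_real l_min) x" using assms by (simp add: pencil_eigvec_iff_K)
  qed
  also have "\<dots> \<longleftrightarrow> Re (sform d K x x) = 0" proof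
    assume "Re (sform d K x x) = 0"
    with sform_self_real[OF psd_K, of x] show "sform d K x x = 0" by (simp only: of_real_0)
  qed simp
  also have "\<dots> \<longleftrightarrow> Re (sform d M x x) / Re (sform d G x x) = l_min"
    using pos by (auto simp: sform_diff_scaled field_simps)
  finally show ?thesis .
qed

text \<open>Pairing the eigenvalue equation with \<open>c\<close> itself exhibits
  \<open>\<mu>\<close> as a Rayleigh quotient; it is therefore real and at least
  \<open>l_min\<close>.\<close>

lemma smallest_l_min: "smallest_gen_eigenvalue (pencil_M R Bs) (pencil_G Bs) l_min"
  unfolding smallest_gen_eigenvalue_def gen_eigenvalue_def
proof (intro conjI allI impI)
  show "\<exists>c. gen_eigenvector (pencil_M R Bs) (pencil_G Bs) (of_real l_min) c"
    using null_vec_eigvec by blast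
  fix \<mu> assume "\<exists>c. gen_eigenvector (pencil_M R Bs) (pencil_G Bs) \<mu> c"
  then obtain c :: "complex vec" where c: "pencil_eigvec d M G \<mu> (($) c)" by (auto simp: gen_eigenvector_iff)
  define x where "x = ($) c"
  have pos: "Re (sform d G x x) > 0"
    using c by (intro pd_pos[OF pd_G]) (simp add: x_def pencil_eigvec_def)
  have "sform d M x x = \<mu> * sform d G x x"
    using pencil_eigvec_sform[OF c] by (simp add: x_def)
  then have "of_real (Re (sform d M x x)) = \<mu> * of_real (Re (sform d G x x))"
    using sform_self_real[OF psd_M, of x] sform_self_real[OF psd_G, of x] by (simp only:)
  then have \<mu>: "\<mu> = of_real (Re (sform d M x x) / Re (sform d G x x))"
    using pos by (simp add: field_simps)
  show "\<mu> \<in> \<real>" unfolding \<mu> by (rule Reals_of_real)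
  show "l_min \<le> Re \<mu>"
    unfolding \<mu> using l_min[of x] pos by (simp add: pos_le_divide_eq)
qed

lemma lincomb_nonzero_iff:
  assumes "c \<in> carrier_vec d"
  shows "mat_lincomb m Bs c \<noteq> 0\<^sub>m m m \<longleftrightarrow> (\<exists>i<d. c $ i \<noteq> 0)"
proof
  assume "mat_lincomb m Bs c \<noteq> 0\<^sub>m m m"
  show "\<exists>i<d. c $ i \<noteq> 0"
  proof (rule ccontr)
    assume "\<not> ?thesis"
    then have "mat_lincomb m Bs c = 0\<^sub>m m m"
      unfolding mat_lincomb_eq length_Bs by (intro eq_matI) (simp_all add: lincomb_def)
    then show False using \<open>mat_lincomb m Bs c \<noteq> 0\<^sub>m m m\<close> by simp
  qed
next
  assume "\<exists>i<d. c $ i \<noteq> 0"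
  then show "mat_lincomb m Bs c \<noteq> 0\<^sub>m m m"
    using lincomb_eq_0[of "($) c"] unfolding mat_lincomb_eq length_Bs by blast
qed

text \<open>The lower bound \<open>l_min\<close> is attained at the null vector, so being a
  minimizer means having quotient \<open>l_min\<close>, which \<open>eigvec_iff_quotient\<close>
  translates into the eigenvector equation for the coefficients.\<close>

lemma minimizers:
  "{A. is_arg_min (commutator_quotient R) (\<lambda>X. X \<in> mat_span m Bs - {0\<^sub>m m m}) A} =
   {mat_lincomb m Bs c | c. gen_eigenvector (pencil_M R Bs) (pencil_G Bs) (of_real l_min) c}"
proof -
  let ?q = "commutator_quotient R" and ?S = "mat_span m Bs - {0\<^sub>m m m}"
  have q: "?q (mat_lincomb m Bs c) = Re (sform d M (($) c) (($) c)) / Re (sform d G (($) c) (($) c))" for c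
    using quotient_eq[of "($) c"] by (simp add: mat_lincomb_eq length_Bs)
  have S: "A \<in> ?S \<longleftrightarrow> (\<exists>c\<in>carrier_vec d. A = mat_lincomb m Bs c \<and> (\<exists>i<d. c $ i \<noteq> 0))" for A
    using lincomb_nonzero_iff by (auto simp: mat_span_def length_Bs)
  have eig: "gen_eigenvector (pencil_M R Bs) (pencil_G Bs) (of_real l_min) c \<longleftrightarrow>
      c \<in> carrier_vec d \<and> (\<exists>i<d. c $ i \<noteq> 0) \<and> ?q (mat_lincomb m Bs c) = l_min" for c
    unfolding gen_eigenvector_iff q using eigvec_iff_quotient[of "($) c"] by (auto simp: pencil_eigvec_def)
  have lower: "l_min \<le> ?q A" if "A \<in> ?S" for A
  proof -
    obtain c :: "complex vec" where c: "A = mat_lincomb m Bs c" "\<exists>i<d. c $ i \<noteq> 0" using \<open>A \<in> ?S\<close> unfolding S by blast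
    show ?thesis unfolding c(1) q using l_min[of "($) c"] pd_pos[OF pd_G c(2)] by (simp add: pos_le_divide_eq)
  qed
  let ?c = "vec d (null_vec d K)"
  have attained: "?q (mat_lincomb m Bs ?c) = l_min" "mat_lincomb m Bs ?c \<in> ?S"
    using null_vec_eigvec unfolding eig S by blast+
  have "is_arg_min ?q (\<lambda>X. X \<in> ?S) A \<longleftrightarrow> A \<in> ?S \<and> ?q A = l_min" for A
  proof
    assume "is_arg_min ?q (\<lambda>X. X \<in> ?S) A"
    then have A: "A \<in> ?S" and "\<not> ?q (mat_lincomb m Bs ?c) < ?q A"
      unfolding is_arg_min_def using attained(2) by blast+
    then have "?q A = l_min" using lower[OF A] attained(1) by linarith
    with A show "A \<in> ?S \<and> ?q A = l_min" by blast
  next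
    assume A: "A \<in> ?S \<and> ?q A = l_min"
    have "\<not> ?q X < ?q A" if "X \<in> ?S" for X using lower[OF that] A by linarith
    with A show "is_arg_min ?q (\<lambda>X. X \<in> ?S) A" unfolding is_arg_min_def by blast
  qed
  then have "{A. is_arg_min ?q (\<lambda>X. X \<in> ?S) A} = {A. A \<in> ?S \<and> ?q A = l_min}" by (simp only:)
  also have "\<dots> = {mat_lincomb m Bs c | c. gen_eigenvector (pencil_M R Bs) (pencil_G Bs) (of_real l_min) c}"
    unfolding eig S by blast
  finally show ?thesis .
qed

lemma hermitian_pencil: "hermitian_mat (pencil_M R Bs)" "hermitian_mat (pencil_G Bs)"
proof -
  have "hermitian_mat H" if H: "H \<in> carrier_mat d d" and psd: "psd d (\<lambda>i j. H $$ (i, j))" for H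
    unfolding hermitian_mat_def
  proof (rule eq_matI)
    fix i j assume "i < dim_row H" "j < dim_col H"
    then have ij: "i < d" "j < d" using H by auto
    then have "H $$ (i, j) = cnj (H $$ (j, i))" using psd unfolding psd_def by blast
    then show "mat_adjoint H $$ (i, j) = H $$ (i, j)" using ij H by simp
  qed (use H in auto)
  then show "hermitian_mat (pencil_M R Bs)" "hermitian_mat (pencil_G Bs)"
    using pencil_carrier psd_M psd_G by blast+
qed

section \<open>Reduction to an ordinary eigenvalue problem\<close>

definition G_inv :: "complex mat" where "G_inv = mat d d (\<lambda>(i, j). pd_inverse d G i j)"

text \<open>In general not Hermitian, which is why the traces of its powers are found from a Schur
  form rather than from an orthonormal eigenbasis.\<close>

definition N :: "complex mat" where "N = G_inv * pencil_M R Bs"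

lemma G_inv_carrier: "G_inv \<in> carrier_mat d d" and N_carrier: "N \<in> carrier_mat d d"
  using pencil_carrier by (auto simp: G_inv_def N_def)

lemma G_inv: "G_inv * pencil_G Bs = 1\<^sub>m d" "pencil_G Bs * G_inv = 1\<^sub>m d"
proof -
  show *: "G_inv * pencil_G Bs = 1\<^sub>m d"
  proof (rule eq_matI)
    fix i j assume "i < dim_row (1\<^sub>m d :: complex mat)" "j < dim_col (1\<^sub>m d :: complex mat)"
    then have ij: "i < d" "j < d" by auto
    have "(G_inv * pencil_G Bs) $$ (i, j) = (\<Sum>k<d. pd_inverse d G i k * G k j)"
      unfolding mult_mat_index[OF G_inv_carrier pencil_carrier(2) ij] using ij by (simp add: G_inv_def)
    also have "\<dots> = (\<Sum>k<d. pd_inverse d G i k * (\<Sum>l<d. G k l * (if l = j then 1 else 0)))"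
      using ij by (simp add: if_distrib[of "(*) _"] cong: if_cong)
    also have "\<dots> = (if i = j then 1 else 0)" using pd_inverse_left[OF pd_G ij(1)] .
    finally show "(G_inv * pencil_G Bs) $$ (i, j) = 1\<^sub>m d $$ (i, j)" using ij by simp
  qed (use G_inv_carrier pencil_carrier in auto)
  show "pencil_G Bs * G_inv = 1\<^sub>m d"
    using mat_mult_left_right_inverse[OF G_inv_carrier pencil_carrier(2) *] .
qed

lemma gen_eigenvector_N: "gen_eigenvector (pencil_M R Bs) (pencil_G Bs) \<mu> c \<longleftrightarrow> eigenvector N c \<mu>"
proof (cases "c \<in> carrier_vec d")
  case True
  let ?M = "pencil_M R Bs" and ?G = "pencil_G Bs"
  have "?M *\<^sub>v c = \<mu> \<cdot>\<^sub>v (?G *\<^sub>v c) \<longleftrightarrow> N *\<^sub>v c = \<mu> \<cdot>\<^sub>v c"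
  proof
    assume *: "?M *\<^sub>v c = \<mu> \<cdot>\<^sub>v (?G *\<^sub>v c)"
    have "N *\<^sub>v c = G_inv *\<^sub>v (\<mu> \<cdot>\<^sub>v (?G *\<^sub>v c))"
      unfolding N_def *[symmetric] using True pencil_carrier G_inv_carrier by (intro assoc_mult_mat_vec)
    also have "\<dots> = \<mu> \<cdot>\<^sub>v (G_inv *\<^sub>v (?G *\<^sub>v c))"
      using True pencil_carrier G_inv_carrier by (intro mult_mat_vec) auto
    also have "G_inv *\<^sub>v (?G *\<^sub>v c) = G_inv * ?G *\<^sub>v c"
      using True pencil_carrier G_inv_carrier by (intro assoc_mult_mat_vec[symmetric])
    also have "\<dots> = c" using True by (simp add: G_inv)
    finally show "N *\<^sub>v c = \<mu> \<cdot>\<^sub>v c" .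
  next
    assume *: "N *\<^sub>v c = \<mu> \<cdot>\<^sub>v c"
    have "?M *\<^sub>v c = (?G * G_inv) * ?M *\<^sub>v c"
      using pencil_carrier by (simp add: G_inv)
    also have "\<dots> = ?G * N *\<^sub>v c"
      unfolding N_def using pencil_carrier G_inv_carrier by (subst assoc_mult_mat) auto
    also have "\<dots> = ?G *\<^sub>v (N *\<^sub>v c)"
      using True pencil_carrier N_carrier by (intro assoc_mult_mat_vec)
    also have "\<dots> = \<mu> \<cdot>\<^sub>v (?G *\<^sub>v c)"
      unfolding * using True pencil_carrier by (intro mult_mat_vec) auto
    finally show "?M *\<^sub>v c = \<mu> \<cdot>\<^sub>v (?G *\<^sub>v c)" .
  qed
  then show ?thesis using pencil_carrier N_carrier by (simp add: gen_eigenvector_def eigenvector_def)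
next
  case False
  then show ?thesis using pencil_carrier N_carrier by (simp add: gen_eigenvector_def eigenvector_def)
qed

text \<open>The roots of the characteristic polynomial are the generalized eigenvalues. The
  polynomial is monic, so there are finitely many roots, and \<open>l_min\<close> is one; hence the
  default value in \<open>least_real_root\<close> does not arise.\<close>

lemma least_real_root_N: "least_real_root (char_poly N) = l_min"
proof -
  let ?Z = "{x :: real. poly (char_poly N) (of_real x) = 0}"
  have root: "poly (char_poly N) \<mu> = 0 \<longleftrightarrow> gen_eigenvalue (pencil_M R Bs) (pencil_G Bs) \<mu>" for \<mu>
    unfolding eigenvalue_root_char_poly[OF N_carrier, symmetric] eigenvalue_def gen_eigenvalue_def
    using gen_eigenvector_N by blast
  have "char_poly N \<noteq> 0" using degree_monic_char_poly[OF N_carrier] by auto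
  then have "finite {z. poly (char_poly N) z = 0}" by (rule poly_roots_finite)
  then have "finite (of_real ` ?Z :: complex set)" by (rule finite_subset[rotated]) auto
  then have fin: "finite ?Z" by (rule finite_imageD) (simp add: inj_on_def)
  have "l_min \<in> ?Z" "\<And>x. x \<in> ?Z \<Longrightarrow> l_min \<le> x"
    using smallest_l_min unfolding root smallest_gen_eigenvalue_def by force+
  then have "Min ?Z = l_min" "?Z \<noteq> {}" using fin by (auto intro: Min_eqI)
  then show ?thesis using fin by (simp add: least_real_root_def)
qed

text \<open>This is what brings the cost \<open>m d\<^sup>3\<close> of the matrix powers below \<open>d\<^sup>2 m\<^sup>3\<close>.\<close>

lemma d_le: "d \<le> m * m"
proof (rule ccontr)
  assume "\<not> d \<le> m * m"
  then have less: "m * m < d" by simp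
  \<comment> \<open>The columns are the flattened matrices of the family, padded with zero rows to a
    square matrix. If \<open>m * m < d\<close>, row \<open>m * m\<close> is zero, so the determinant
    vanishes, and a kernel vector of \<open>A\<close> is a linear dependence.\<close>
  define A where "A = mat d d (\<lambda>(p, j). if p < m * m then Bs ! j $$ (p div m, p mod m) else 0)"
  have A: "A \<in> carrier_mat d d" by (simp add: A_def)
  have "det (transpose_mat A) = 0"
  proof (subst det_0_iff_vec_prod_zero[of _ d])
    have "transpose_mat A *\<^sub>v unit_vec d (m * m) = 0\<^sub>v d"
      using less by (intro eq_vecI) (simp_all add: A_def)
    then show "\<exists>v. v \<in> carrier_vec d \<and> v \<noteq> 0\<^sub>v d \<and> transpose_mat A *\<^sub>v v = 0\<^sub>v d"
      using less by (intro exI[of _ "unit_vec d (m * m)"]) (simp add: unit_vec_nonzero)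
  qed (simp add: A)
  then have "det A = 0" using det_transpose[OF A] by simp
  then obtain v where v: "v \<in> carrier_vec d" "v \<noteq> 0\<^sub>v d" "A *\<^sub>v v = 0\<^sub>v d"
    using det_0_iff_vec_prod_zero[OF A] by blast
  have "mat_lincomb m Bs v = 0\<^sub>m m m"
  proof (rule eq_matI)
    fix i k assume "i < dim_row (0\<^sub>m m m :: complex mat)" "k < dim_col (0\<^sub>m m m :: complex mat)"
    then have ik: "i < m" "k < m" by auto
    let ?p = "i * m + k"
    have "?p < (i + 1) * m" using ik by simp
    also have "\<dots> \<le> m * m" using ik by (intro mult_le_mono1) simp
    finally have p: "?p < m * m" .
    have "(A *\<^sub>v v) $ ?p = (\<Sum>j<d. A $$ (?p, j) * v $ j)"
      using p less v(1) A by (simp add: scalar_prod_def atLeast0LessThan)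
    also have "\<dots> = (\<Sum>j<d. v $ j * Bs ! j $$ (i, k))"
      using p less ik by (simp add: A_def mult.commute)
    finally show "mat_lincomb m Bs v $$ (i, k) = 0\<^sub>m m m $$ (i, k)"
      using ik v(3) p less by (simp add: mat_lincomb_def length_Bs)
  qed (simp_all add: mat_lincomb_def)
  then show False using indep v unfolding mat_lin_indep_def length_Bs by blast
qed

end

section \<open>Straight-line programs\<close>

text \<open>A value depending on the input is a function on the set \<open>X\<close> of admissible inputs, \<open>st\<close> being the
  initial memory. \<open>computed X st c S\<close> says that one program of cost at most \<open>c\<close>, the same for all
  inputs, leaves every value in \<open>S\<close> in some register; \<open>derives X c S T\<close> says that any such program can
  be prolonged at cost \<open>c\<close> so as to produce also the values in \<open>T\<close>. Register addresses never have to
  be named in this way.\<close>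

definition computed :: "'x set \<Rightarrow> ('x \<Rightarrow> nat \<Rightarrow> complex) \<Rightarrow> nat \<Rightarrow> ('x \<Rightarrow> complex) set \<Rightarrow> bool" where
  "computed X st c S \<longleftrightarrow> finite S \<and>
     (\<exists>P \<rho>. cost P \<le> c \<and> (\<forall>f\<in>S. \<forall>x\<in>X. run P (st x) (\<rho> f) = f x))"

definition derives :: "'x set \<Rightarrow> nat \<Rightarrow> ('x \<Rightarrow> complex) set \<Rightarrow> ('x \<Rightarrow> complex) set \<Rightarrow> bool" where
  "derives X c S T \<longleftrightarrow>
     (\<forall>st b U. S \<subseteq> U \<longrightarrow> computed X st b U \<longrightarrow> computed X st (b + c) (U \<union> T))"

lemma computedI:
  assumes "finite S" "cost P \<le> c" "\<And>f x. f \<in> S \<Longrightarrow> x \<in> X \<Longrightarrow> run P (st x) (\<rho> f) = f x"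
  shows "computed X st c S"
  unfolding computed_def
  by (intro conjI exI[of _ P] exI[of _ \<rho>] ballI) (rule assms; assumption)+

lemma computedE:
  assumes "computed X st c S"
  obtains P \<rho> where "finite S" "cost P \<le> c" "\<forall>f\<in>S. \<forall>x\<in>X. run P (st x) (\<rho> f) = f x"
  using assms unfolding computed_def by (elim conjE exE)

lemma computed_mono:
  assumes "computed X st c S" "S' \<subseteq> S" "c \<le> c'"
  shows "computed X st c' S'"
proof -
  obtain P \<rho> where P: "finite S" "cost P \<le> c"
    and run: "\<forall>f\<in>S. \<forall>x\<in>X. run P (st x) (\<rho> f) = f x"
    by (rule computedE[OF assms(1)])
  note run = bspec[OF bspec[OF run]]
  show ?thesis
  proof (rule computedI)
    show "finite S'" using P(1) assms(2) by (rule finite_subset[rotated])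
    show "cost P \<le> c'" using P(2) assms(3) by simp
    fix f x assume "f \<in> S'" "x \<in> X"
    with assms(2) show "run P (st x) (\<rho> f) = f x" by (intro run) auto
  qed
qed

lemma derives_mono:
  assumes "derives X c S T" "S \<subseteq> S'" "T' \<subseteq> T" "c \<le> c'"
  shows "derives X c' S' T'"
  unfolding derives_def
proof (intro allI impI)
  fix st b U assume "S' \<subseteq> U" "computed X st b U"
  then have "computed X st (b + c) (U \<union> T)"
    using assms unfolding derives_def by blast
  then show "computed X st (b + c') (U \<union> T')"
    by (rule computed_mono) (use assms in auto)
qed

lemma derives_subset: "T \<subseteq> S \<Longrightarrow> derives X 0 S T"
  by (auto simp: derives_def intro: computed_mono)

lemma derives_trans:
  assumes "derives X c S T" "derives X c' (S \<union> T) T'"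
  shows "derives X (c + c') S (T \<union> T')"
  unfolding derives_def
proof (intro allI impI)
  fix st b U assume "S \<subseteq> U" "computed X st b U"
  then have "computed X st (b + c) (U \<union> T)"
    using assms(1) unfolding derives_def by blast
  moreover have "S \<union> T \<subseteq> U \<union> T" using \<open>S \<subseteq> U\<close> by blast
  ultimately have "computed X st (b + c + c') (U \<union> T \<union> T')"
    using assms(2) unfolding derives_def by blast
  then show "computed X st (b + (c + c')) (U \<union> (T \<union> T'))"
    by (simp add: add.assoc Un_assoc)
qed

lemma derives_iterate:
  assumes "\<And>k. k < n \<Longrightarrow> derives X c (S \<union> (\<Union>j<k. T j)) (T k)"
  shows "derives X (n * c) S (\<Union>k<n. T k)"
  using assms
proof (induction n)
  case 0
  then show ?case by (simp add: derives_subset)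
next
  case (Suc n)
  have "derives X (n * c + c) S ((\<Union>k<n. T k) \<union> T n)"
    by (rule derives_trans) (use Suc in auto)
  then show ?case by (simp add: lessThan_Suc add.commute Un_commute)
qed

lemma derives_UN:
  assumes "\<And>k. k < n \<Longrightarrow> derives X c S (T k)"
  shows "derives X (n * c) S (\<Union>k<n. T k)"
  by (rule derives_iterate) (rule derives_mono[OF assms], auto)

text \<open>As only finitely many values are in use, some \<open>r\<close> lies above all their
  registers. The fragment \<open>P\<close>, given the register map and \<open>r\<close>, must leave
  the result in \<open>r\<close> and preserve everything below; the registers beyond
  \<open>r\<close> are free as scratch.\<close>

lemma derives_instr:
  fixes P :: "(('x \<Rightarrow> complex) \<Rightarrow> nat) \<times> nat \<Rightarrow> prog"
  assumes "\<And>r. cost (P r) \<le> c"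
    and "\<And>\<rho> r s x. x \<in> X \<Longrightarrow> \<forall>f\<in>S. \<rho> f < r \<and> s (\<rho> f) = f x \<Longrightarrow>
      run (P (\<rho>, r)) s r = g x \<and> (\<forall>i<r. run (P (\<rho>, r)) s i = s i)"
  shows "derives X c S {g}"
  unfolding derives_def
proof (intro allI impI)
  fix st b U assume SU: "S \<subseteq> U" and U: "computed X st b U"
  obtain Q \<rho> where fin: "finite U" and Q: "cost Q \<le> b"
    and run: "\<forall>f\<in>U. \<forall>x\<in>X. run Q (st x) (\<rho> f) = f x"
    by (rule computedE[OF U])
  note run = bspec[OF bspec[OF run]]
  obtain r where r: "\<rho> ` U \<subseteq> {..<r}"
    using finite_nat_bounded[of "\<rho> ` U"] fin by auto
  show "computed X st (b + c) (U \<union> {g})"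
  proof (rule computedI)
    show "finite (U \<union> {g})" using fin by simp
    show "cost (Seq Q (P (\<rho>, r))) \<le> b + c" using Q assms(1)[of "(\<rho>, r)"] by simp
    fix f x assume f: "f \<in> U \<union> {g}" and x: "x \<in> X"
    have U: "\<rho> f < r \<and> run Q (st x) (\<rho> f) = f x" if "f \<in> U" for f
      using r that run[OF that x] by auto
    have "\<forall>f\<in>S. \<rho> f < r \<and> run Q (st x) (\<rho> f) = f x"
    proof
      fix f assume "f \<in> S"
      then have "f \<in> U" using SU by (rule subsetD[rotated])
      then show "\<rho> f < r \<and> run Q (st x) (\<rho> f) = f x" by (rule U)
    qed
    note * = assms(2)[OF x this]
    \<comment> \<open>If \<open>g\<close> is already in \<open>U\<close>, its old register is kept,
      which is still intact.\<close>
    show "run (Seq Q (P (\<rho>, r))) (st x) (if f \<in> U then \<rho> f else r) = f x"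
    proof (cases "f \<in> U")
      case True
      with U[OF True] * show ?thesis by simp
    next
      case False
      then have "f = g" using f by simp
      with False * show ?thesis by simp
    qed
  qed
qed

text \<open>Values are functions on the whole type, so two formulas that agree only on admissible
  inputs are different values. They can share a register, and passing from one to the other costs
  nothing; this is how mathematical identities enter the programs.\<close>

lemma derives_cong:
  assumes "derives X c S {f}" "\<And>x. x \<in> X \<Longrightarrow> f x = g x"
  shows "derives X c S {g}"
proof -
  have "derives X 0 {f} {g}"
    unfolding derives_def
  proof (intro allI impI)
    fix st b U assume fU: "{f} \<subseteq> U" and U: "computed X st b U"
    obtain P \<rho> where fin: "finite U" and P: "cost P \<le> b"
      and run: "\<forall>h\<in>U. \<forall>x\<in>X. run P (st x) (\<rho> h) = h x"
    by (rule computedE[OF U])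
  note run = bspec[OF bspec[OF run]]
    show "computed X st (b + 0) (U \<union> {g})"
    proof (rule computedI)
      show "finite (U \<union> {g})" "cost P \<le> b + 0" using fin P by simp_all
      fix h x assume h: "h \<in> U \<union> {g}" and x: "x \<in> X"
      show "run P (st x) (if h \<in> U then \<rho> h else \<rho> f) = h x"
      proof (cases "h \<in> U")
        case True
        then show ?thesis using run[OF True x] by simp
      next
        case False
        then have "h = g" "f \<in> U" using h fU by auto
        then show ?thesis using False run[OF \<open>f \<in> U\<close> x] assms(2)[OF x] by simp
      qed
    qed
  qed
  then have "derives X (c + 0) S ({f} \<union> {g})"
    by (intro derives_trans[OF assms(1)]) (rule derives_mono, auto)
  then show ?thesis by (rule derives_mono) auto
qed

lemma derives_binop:
  assumes "derives X a S {f}" "derives X b S {g}" "derives X c {f, g} {h}"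
  shows "derives X (a + b + c) S {h}"
proof -
  have "derives X (a + b) S ({f} \<union> {g})"
    by (rule derives_trans[OF assms(1)]) (rule derives_mono[OF assms(2)], auto)
  then have "derives X (a + b + c) S ({f} \<union> {g} \<union> {h})"
    by (rule derives_trans) (rule derives_mono[OF assms(3)], auto)
  then show ?thesis by (rule derives_mono) auto
qed

lemma derives_const: "derives X 1 S {\<lambda>_. of_int k}"
  by (rule derives_instr[where P = "\<lambda>(\<rho>, r). Const r k"]) auto

lemma derives_member: "f \<in> S \<Longrightarrow> derives X 0 S {f}"
  by (rule derives_subset) simp

lemma derives_add:
  assumes "derives X a S {f}" "derives X b S {g}"
  shows "derives X (a + b + 1) S {\<lambda>x. f x + g x}"
  using assms by (rule derives_binop)
    (rule derives_instr[where P = "\<lambda>(\<rho>, r). Add r (\<rho> f) (\<rho> g)"], auto)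

lemma derives_diff:
  assumes "derives X a S {f}" "derives X b S {g}"
  shows "derives X (a + b + 1) S {\<lambda>x. f x - g x}"
  using assms by (rule derives_binop)
    (rule derives_instr[where P = "\<lambda>(\<rho>, r). Sub r (\<rho> f) (\<rho> g)"], auto)

lemma derives_mult:
  assumes "derives X a S {f}" "derives X b S {g}"
  shows "derives X (a + b + 1) S {\<lambda>x. f x * g x}"
  using assms by (rule derives_binop)
    (rule derives_instr[where P = "\<lambda>(\<rho>, r). Mul r (\<rho> f) (\<rho> g)"], auto)

lemma derives_divide:
  assumes "derives X a S {f}" "derives X b S {g}"
  shows "derives X (a + b + 1) S {\<lambda>x. f x / g x}"
  using assms by (rule derives_binop)
    (rule derives_instr[where P = "\<lambda>(\<rho>, r). Div r (\<rho> f) (\<rho> g)"], auto)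

lemma derives_cnj:
  assumes "derives X a S {f}"
  shows "derives X (a + 1) S {\<lambda>x. cnj (f x)}"
proof -
  have "derives X 1 {f} {\<lambda>x. cnj (f x)}"
    by (rule derives_instr[where P = "\<lambda>(\<rho>, r). Cnj r (\<rho> f)"]) auto
  then have "derives X (a + 1) S ({f} \<union> {\<lambda>x. cnj (f x)})"
    by (intro derives_trans[OF assms]) (rule derives_mono, auto)
  then show ?thesis by (rule derives_mono) auto
qed

text \<open>Besides the terms and the \<open>n\<close> additions, one instruction loads the initial
  0.\<close>

lemma derives_sum:
  assumes "\<And>k. k < n \<Longrightarrow> derives X c S {f k}"
  shows "derives X (n * (c + 1) + 1) S {\<lambda>x. \<Sum>k<n. f k x}"
  using assms
proof (induction n)
  case 0
  show ?case using derives_const[of X S 0] by simp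
next
  case (Suc n)
  have "derives X (n * (c + 1) + 1 + c + 1) S {\<lambda>x. (\<Sum>k<n. f k x) + f n x}"
    by (rule derives_add) (use Suc in auto)
  moreover have "n * (c + 1) + 1 + c + 1 = Suc n * (c + 1) + 1" by simp
  ultimately show ?case by (simp only: sum.lessThan_Suc)
qed

text \<open>There is no move instruction; copying is the addition of a register \<open>z\<close>
  that holds 0.\<close>

fun copy_regs :: "nat \<Rightarrow> nat \<Rightarrow> nat list \<Rightarrow> prog" where
  "copy_regs z r [] = Skip"
| "copy_regs z r (a # as) = Seq (Add r a z) (copy_regs z (Suc r) as)"

lemma cost_copy_regs [simp]: "cost (copy_regs z r as) = length as"
  by (induction as arbitrary: r) auto

lemma run_copy_regs:
  assumes "s z = 0" "z \<notin> {r..<r + length as}" "set as \<inter> {r..<r + length as} = {}"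
  shows "run (copy_regs z r as) s =
    (\<lambda>i. if r \<le> i \<and> i < r + length as then s (as ! (i - r)) else s i)"
  using assms
proof (induction as arbitrary: r s)
  case Nil
  then show ?case by (auto simp: fun_eq_iff)
next
  case (Cons a as)
  let ?s = "s(r := s a + s z)"
  have notin: "b \<notin> {r..<Suc r + length as}" if "b \<in> set (a # as)" for b
    using Cons.prems(3) that by auto
  have tl: "run (copy_regs z (Suc r) as) ?s =
    (\<lambda>i. if Suc r \<le> i \<and> i < Suc r + length as then ?s (as ! (i - Suc r)) else ?s i)"
  proof (rule Cons.IH)
    show "?s z = 0" using Cons.prems(1,2) by auto
    show "z \<notin> {Suc r..<Suc r + length as}" using Cons.prems(2) by auto
    show "set as \<inter> {Suc r..<Suc r + length as} = {}" using Cons.prems(3) by auto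
  qed
  have nth: "?s (as ! (i - Suc r)) = s ((a # as) ! (i - r))"
    if "Suc r \<le> i" "i < Suc r + length as" for i
  proof -
    have "as ! (i - Suc r) \<in> set as" using that by (intro nth_mem) auto
    then have "as ! (i - Suc r) \<noteq> r" using notin[of "as ! (i - Suc r)"] by auto
    then show ?thesis using that by (auto simp: nth_Cons' Suc_diff_le)
  qed
  show ?case
  proof
    fix i
    have "run (copy_regs z r (a # as)) s i =
      (if Suc r \<le> i \<and> i < Suc r + length as then ?s (as ! (i - Suc r)) else ?s i)"
      using tl by simp
    also have "\<dots> = (if r \<le> i \<and> i < r + length (a # as) then s ((a # as) ! (i - r)) else s i)"
    proof (cases "i = r")
      case True
      then show ?thesis using Cons.prems(1) by simp
    next
      case False
      show ?thesis
      proof (cases "Suc r \<le> i \<and> i < Suc r + length as")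
        case True
        then show ?thesis using nth[of i] by simp
      next
        case False
        then have "\<not> (r \<le> i \<and> i < r + length (a # as))" using \<open>i \<noteq> r\<close> by auto
        then show ?thesis using False \<open>i \<noteq> r\<close> by auto
      qed
    qed
    finally show "run (copy_regs z r (a # as)) s i =
      (if r \<le> i \<and> i < r + length (a # as) then s ((a # as) ! (i - r)) else s i)" .
  qed
qed

lemma run_copy_regs_nth:
  assumes "s z = 0" "z \<notin> {r..<r + length as}" "set as \<inter> {r..<r + length as} = {}" "i < length as"
  shows "run (copy_regs z r as) s (r + i) = s (as ! i)"
  unfolding run_copy_regs[where s = s, OF assms(1-3)] using assms(4) by simp

lemma run_copy_regs_other:
  assumes "s z = 0" "z \<notin> {r..<r + length as}" "set as \<inter> {r..<r + length as} = {}" "i < r \<or> r + length as \<le> i"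
  shows "run (copy_regs z r as) s i = s i"
  unfolding run_copy_regs[where s = s, OF assms(1-3)] using assms(4) by auto

text \<open>\<open>LeastRoot\<close> expects its coefficients in consecutive registers. They are
  copied to \<open>r, ..., r + n\<close>, with the zero needed for copying in register
  \<open>r + n + 1\<close>, and the root then overwrites register \<open>r\<close>. This accounts
  for \<open>n + 2\<close> operations besides the root.\<close>

lemma derives_least_real_root:
  assumes "\<And>i. i \<le> n \<Longrightarrow> derives X c S {f i}"
  shows "derives X ((n + 1) * c + (n + 2) + (n + 1) ^ 3) S
           {\<lambda>x. of_real (least_real_root (Poly (map (\<lambda>i. f i x) [0..<n + 1])))}"
    (is "derives X _ S {?g}")
proof -
  let ?T = "\<Union>i<Suc n. {f i}"
  have "derives X (n + 2 + (n + 1) ^ 3) ?T {?g}"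
  proof (rule derives_instr)
    define Q where "Q = (\<lambda>(\<rho> :: ('a \<Rightarrow> complex) \<Rightarrow> nat, r :: nat).
      Seq (Const (r + n + 1) 0)
        (Seq (copy_regs (r + n + 1) r (map (\<lambda>i. \<rho> (f i)) [0..<n + 1])) (LeastRoot r r n)))"
    show "cost (Q p) \<le> n + 2 + (n + 1) ^ 3" for p
      by (cases p) (simp add: Q_def)
    fix \<rho> :: "('a \<Rightarrow> complex) \<Rightarrow> nat" and r :: nat and s x
    assume "x \<in> X" and s: "\<forall>f\<in>?T. \<rho> f < r \<and> s (\<rho> f) = f x"
    have less: "\<rho> (f i) < r" and val: "s (\<rho> (f i)) = f i x" if "i < n + 1" for i
    proof -
      have "f i \<in> ?T" using that by auto
      from bspec[OF s this] show "\<rho> (f i) < r" "s (\<rho> (f i)) = f i x" by (rule conjunct1, rule conjunct2)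
    qed
    let ?z = "r + n + 1" and ?as = "map (\<lambda>i. \<rho> (f i)) [0..<n + 1]"
    let ?s = "s(?z := 0)"
    let ?t = "run (copy_regs ?z r ?as) ?s"
    have disj: "set ?as \<inter> {r..<r + length ?as} = {}"
    proof -
      have "a < r" if "a \<in> set ?as" for a
      proof -
        from that obtain i where "a = \<rho> (f i)" "i \<in> set [0..<n + 1]"
          unfolding set_map by (elim imageE)
        then show ?thesis using less[of i] by (simp del: upt_Suc)
      qed
      then show ?thesis by (meson Int_emptyI atLeastLessThan_iff linorder_not_less)
    qed
    have "map ?t [r..<r + n + 1] = map (\<lambda>i. f i x) [0..<n + 1]"
    proof (rule nth_equalityI)
      fix i assume "i < length (map ?t [r..<r + n + 1])"
      then have i: "i < n + 1" by simp
      have "?t (r + i) = ?s (?as ! i)"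
        by (rule run_copy_regs_nth) (use disj i in \<open>simp_all del: upt_Suc\<close>)
      also have "?as ! i = \<rho> (f i)" using i by (simp del: upt_Suc)
      also have "?s (\<rho> (f i)) = f i x" using less[OF i] val[OF i] by simp
      finally have "?t (r + i) = f i x" .
      then show "map ?t [r..<r + n + 1] ! i = map (\<lambda>i. f i x) [0..<n + 1] ! i"
        using i by (simp del: upt_Suc)
    qed simp
    moreover have "?t i = s i" if "i < r" for i
    proof -
      have "?t i = ?s i"
        by (rule run_copy_regs_other) (use disj that in \<open>simp_all del: upt_Suc\<close>)
      then show ?thesis using that by simp
    qed
    moreover have "run (Q (\<rho>, r)) s =
        ?t(r := of_real (least_real_root (Poly (map ?t [r..<r + n + 1]))))"
      by (simp add: Q_def del: upt_Suc)
    ultimately show "run (Q (\<rho>, r)) s r = ?g x \<and> (\<forall>i<r. run (Q (\<rho>, r)) s i = s i)"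
      by (simp only:) simp
  qed
  then have "derives X (Suc n * c + (n + 2 + (n + 1) ^ 3)) S (?T \<union> {?g})"
    by (intro derives_trans[OF derives_UN derives_mono[OF _ Un_upper2 order_refl order_refl]] assms) auto
  then show ?thesis by (rule derives_mono) auto
qed

lemma computed_load:
  assumes "\<And>x. x \<in> X \<Longrightarrow> inp x = map (\<lambda>f. f x) fs"
  shows "computed X (\<lambda>x. load (inp x)) 0 (set fs)"
proof -
  have "\<exists>r. \<forall>x\<in>X. load (inp x) r = f x" if f: "f \<in> set fs" for f
  proof -
    obtain r where "r < length fs" "fs ! r = f" using f by (auto simp: in_set_conv_nth)
    then show ?thesis by (intro exI[of _ r]) (auto simp: load_def assms)
  qed
  then have "\<forall>f\<in>set fs. \<exists>r. \<forall>x\<in>X. load (inp x) r = f x" by (intro ballI)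
  from bchoice[OF this] obtain \<rho> where \<rho>: "\<forall>f\<in>set fs. \<forall>x\<in>X. load (inp x) (\<rho> f) = f x" ..
  show ?thesis
  proof (rule computedI)
    show "cost Skip \<le> 0" by simp
    show "run Skip (load (inp x)) (\<rho> f) = f x" if "f \<in> set fs" "x \<in> X" for f x
      using bspec[OF bspec[OF \<rho> that(1)] that(2)] by simp
  qed simp
qed

text \<open>The outputs have to end in the registers from 0 on, where values still to be copied may
  be stored. They are therefore first moved to a block starting at some \<open>N\<close> above all
  sources and not below the number of outputs, and from there to their places: two copies of each
  and one zero register.\<close>

lemma computed_computes:
  assumes "computed X (\<lambda>x. load (inp x)) c (set fs)"
  shows "\<exists>P. cost P \<le> c + 2 * length fs + 1 \<and> (\<forall>x\<in>X. computes P (inp x) (map (\<lambda>f. f x) fs))"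
proof -
  obtain Q \<rho> where "finite (set fs)" and Q: "cost Q \<le> c"
    and run: "\<forall>f\<in>set fs. \<forall>x\<in>X. run Q (load (inp x)) (\<rho> f) = f x"
    by (rule computedE[OF assms])
  note run = bspec[OF bspec[OF run]]
  let ?as = "map \<rho> fs" and ?l = "length fs"
  obtain N where N: "\<forall>f\<in>set fs. \<rho> f < N" "?l \<le> N"
  proof -
    obtain k where "\<forall>f\<in>set fs. \<rho> f < k"
      using finite_nat_bounded[of "\<rho> ` set fs"] by auto
    then show ?thesis by (intro that[of "max k ?l"]) auto
  qed
  let ?z = "N + ?l"
  let ?P = "Seq Q (Seq (Const ?z 0) (Seq (copy_regs ?z N ?as) (copy_regs ?z 0 [N..<N + ?l])))"
  show ?thesis
  proof (intro exI conjI ballI)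
    show "cost ?P \<le> c + 2 * ?l + 1" using Q by simp
    fix x assume x: "x \<in> X"
    define s where "s = (run Q (load (inp x)))(?z := 0)"
    define s' where "s' = run (copy_regs ?z N ?as) s"
    have less: "\<rho> f < N" if "f \<in> set fs" for f using N(1) that by blast
    have s': "s' i = (if N \<le> i \<and> i < N + ?l then s (?as ! (i - N)) else s i)" for i
    proof -
      have "set ?as \<inter> {N..<N + length ?as} = {}" using less by fastforce
      then have "s' = (\<lambda>i. if N \<le> i \<and> i < N + length ?as then s (?as ! (i - N)) else s i)"
        unfolding s'_def by (intro run_copy_regs) (simp_all add: s_def)
      then show ?thesis by simp
    qed
    show "computes ?P (inp x) (map (\<lambda>f. f x) fs)"
      unfolding computes_def
    proof (intro allI impI)
      fix i assume "i < length (map (\<lambda>f. f x) fs)"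
      then have i: "i < ?l" by simp
      have "set [N..<N + ?l] \<inter> {0..<0 + length [N..<N + ?l]} = {}" using N(2) by auto
      then have "run (copy_regs ?z 0 [N..<N + ?l]) s' (0 + i) = s' ([N..<N + ?l] ! i)"
        by (intro run_copy_regs_nth) (simp_all add: s' s_def i)
      then have *: "run (copy_regs ?z 0 [N..<N + ?l]) s' i = s' ([N..<N + ?l] ! i)" by simp
      have "[N..<N + ?l] ! i = N + i" using i by simp
      then have "s' ([N..<N + ?l] ! i) = s (\<rho> (fs ! i))" using i by (simp add: s')
      also have "\<dots> = (fs ! i) x" using i x less[of "fs ! i"] by (simp add: s_def run)
      finally show "run ?P (load (inp x)) i = map (\<lambda>f. f x) fs ! i"
        using i * by (simp add: s'_def s_def)
    qed
  qed
qed

section \<open>A program for the pencil problem\<close>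

lemma derives_le: "derives X a S T \<Longrightarrow> a \<le> c \<Longrightarrow> derives X c S T"
  by (rule derives_mono[OF _ subset_refl subset_refl])

lemma derives_computed: "derives X c S T \<Longrightarrow> computed X st b S \<Longrightarrow> computed X st (b + c) (S \<union> T)"
  unfolding derives_def by blast

lemma derives_step: "derives X a S U \<Longrightarrow> derives X c U T \<Longrightarrow> derives X (a + c) S (U \<union> T)"
  by (erule derives_trans) (rule derives_mono[OF _ Un_upper2 subset_refl order_refl])

lemma derives_zero: "derives X 1 S {\<lambda>_. 0}" and derives_one: "derives X 1 S {\<lambda>_. 1}"
  and derives_of_nat: "derives X 1 S {\<lambda>_. of_nat n}"
  using derives_const[of X S 0] derives_const[of X S 1] derives_const[of X S "int n"] by simp_all

definition fam :: "nat \<Rightarrow> nat \<Rightarrow> (nat \<Rightarrow> nat \<Rightarrow> 'x \<Rightarrow> complex) \<Rightarrow> ('x \<Rightarrow> complex) set" where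
  "fam n k f = (\<Union>i<n. \<Union>j<k. {f i j})"

lemma derives_fam:
  assumes "\<And>i j. i < n \<Longrightarrow> j < k \<Longrightarrow> derives X c S {f i j}"
  shows "derives X (n * (k * c)) S (fam n k f)"
  unfolding fam_def by (intro derives_UN assms)

lemma fam_memberI: "i < n \<Longrightarrow> j < k \<Longrightarrow> f i j \<in> fam n k f"
  unfolding fam_def by blast

lemma derives_fam_member: "fam n k f \<subseteq> S \<Longrightarrow> i < n \<Longrightarrow> j < k \<Longrightarrow> derives X 0 S {f i j}"
  by (rule derives_member) (erule subsetD, rule fam_memberI)

abbreviation fam_mat :: "nat \<Rightarrow> ('x \<Rightarrow> complex mat) \<Rightarrow> ('x \<Rightarrow> complex) set" where
  "fam_mat n A \<equiv> fam n n (\<lambda>i j x. A x $$ (i, j))"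

text \<open>Applied along the structure of an expression, these rules build up its exact cost, which
  \<open>derives_le\<close> then compares with the stated bound.\<close>

lemmas derives_arith = derives_add derives_diff derives_mult derives_divide derives_cnj derives_sum

section \<open>Costs of matrix operations, Gram--Schmidt and Newton's identities\<close>

lemma derives_mat_mult:
  assumes S: "fam_mat n A \<subseteq> S" "fam_mat n B \<subseteq> S"
    and carr: "\<And>x. x \<in> X \<Longrightarrow> A x \<in> carrier_mat n n" "\<And>x. x \<in> X \<Longrightarrow> B x \<in> carrier_mat n n"
    and C: "\<And>x. x \<in> X \<Longrightarrow> C x = A x * B x"
  shows "derives X (n * (n * (2 * n + 1))) S (fam_mat n C)"
proof (rule derives_fam)
  fix i j assume ij: "i < n" "j < n"
  have "derives X (2 * n + 1) S {\<lambda>x. \<Sum>l<n. A x $$ (i, l) * B x $$ (l, j)}"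
    by (rule derives_le, (rule derives_arith derives_fam_member[OF S(1)] derives_fam_member[OF S(2)] ij | assumption)+) (simp add: algebra_simps)
  then show "derives X (2 * n + 1) S {\<lambda>x. C x $$ (i, j)}"
    by (rule derives_cong) (simp only: C mult_mat_index[OF carr ij])
qed

lemma derives_commutator:
  assumes S: "fam_mat n A \<subseteq> S" "fam_mat n B \<subseteq> S"
    and carr: "\<And>x. x \<in> X \<Longrightarrow> A x \<in> carrier_mat n n" "\<And>x. x \<in> X \<Longrightarrow> B x \<in> carrier_mat n n"
  shows "derives X (n * (n * (4 * n + 3))) S (fam_mat n (\<lambda>x. commutator (A x) (B x)))"
proof (rule derives_fam)
  fix i j assume ij: "i < n" "j < n"
  have "derives X (4 * n + 3) S
      {\<lambda>x. (\<Sum>l<n. A x $$ (i, l) * B x $$ (l, j)) - (\<Sum>l<n. B x $$ (i, l) * A x $$ (l, j))}"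
    by (rule derives_le, (rule derives_arith derives_fam_member[OF S(1)] derives_fam_member[OF S(2)] ij | assumption)+) (simp add: algebra_simps)
  then show "derives X (4 * n + 3) S {\<lambda>x. commutator (A x) (B x) $$ (i, j)}"
    by (rule derives_cong) (simp only: commutator_index[OF carr ij])
qed

lemma derives_frob_inner:
  assumes S: "fam_mat n A \<subseteq> S" "fam_mat n B \<subseteq> S"
  shows "derives X (n * (3 * n + 2) + 1) S {\<lambda>x. frob_inner n (A x) (B x)}"
  unfolding frob_inner_def
  by (rule derives_le, (rule derives_arith derives_fam_member[OF S(1)] derives_fam_member[OF S(2)] | assumption)+) (simp add: algebra_simps)

lemma derives_trace_mult:
  assumes S: "fam_mat n A \<subseteq> S" "fam_mat n B \<subseteq> S"
    and carr: "\<And>x. x \<in> X \<Longrightarrow> A x \<in> carrier_mat n n" "\<And>x. x \<in> X \<Longrightarrow> B x \<in> carrier_mat n n"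
  shows "derives X (n * (2 * n + 2) + 1) S {\<lambda>x. mat_trace (A x * B x)}"
proof -
  have "derives X (n * (2 * n + 2) + 1) S {\<lambda>x. \<Sum>i<n. \<Sum>l<n. A x $$ (i, l) * B x $$ (l, i)}"
    by (rule derives_le, (rule derives_arith derives_fam_member[OF S(1)] derives_fam_member[OF S(2)] | assumption)+) (simp add: algebra_simps)
  then show ?thesis
  proof (rule derives_cong)
    fix x assume "x \<in> X"
    from carr[OF this] show "(\<Sum>i<n. \<Sum>l<n. A x $$ (i, l) * B x $$ (l, i)) = mat_trace (A x * B x)"
      by (simp add: mat_trace_def mult_mat_index[of _ n n _ n] del: index_mult_mat(1))
  qed
qed

lemma derives_mat_powers:
  assumes S: "fam_mat n A \<subseteq> S" and carr: "\<And>x. x \<in> X \<Longrightarrow> A x \<in> carrier_mat n n"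
  shows "derives X (r * (n * (n * (2 * n + 1)))) S (\<Union>k<r. fam_mat n (\<lambda>x. A x ^\<^sub>m k))"
proof (rule derives_iterate)
  fix k
  show "derives X (n * (n * (2 * n + 1))) (S \<union> (\<Union>j<k. fam_mat n (\<lambda>x. A x ^\<^sub>m j))) (fam_mat n (\<lambda>x. A x ^\<^sub>m k))"
  proof (cases k)
    case 0
    show ?thesis
    proof (rule derives_fam)
      fix i j assume ij: "i < n" "j < n"
      have "derives X (2 * n + 1) (S \<union> (\<Union>j<k. fam_mat n (\<lambda>x. A x ^\<^sub>m j))) {\<lambda>_. of_nat (if i = j then 1 else 0)}"
        by (rule derives_le[OF derives_of_nat]) simp
      then show "derives X (2 * n + 1) (S \<union> (\<Union>j<k. fam_mat n (\<lambda>x. A x ^\<^sub>m j))) {\<lambda>x. (A x ^\<^sub>m k) $$ (i, j)}"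
        by (rule derives_cong) (use carr ij in \<open>simp add: 0 carrier_matD(1)[OF carr]\<close>)
    qed
  next
    case (Suc r)
    show ?thesis
    proof (rule derives_mat_mult)
      show "fam_mat n (\<lambda>x. A x ^\<^sub>m r) \<subseteq> S \<union> (\<Union>j<k. fam_mat n (\<lambda>x. A x ^\<^sub>m j))"
        using Suc by blast
      show "fam_mat n A \<subseteq> S \<union> (\<Union>j<k. fam_mat n (\<lambda>x. A x ^\<^sub>m j))"
        using S by blast
    qed (use carr in \<open>simp_all add: Suc\<close>)
  qed
qed

lemma derives_sform:
  assumes S: "fam d d (\<lambda>i j x. H x i j) \<subseteq> S" "\<And>i. i < d \<Longrightarrow> (\<lambda>x. v x i) \<in> S"
  shows "derives X (d * (2 * d + 4) + 1) S {\<lambda>x. sform d (H x) (v x) (v x)}"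
proof -
  note v = derives_member[OF S(2)]
  show ?thesis unfolding sform_def
    by (rule derives_le, (rule derives_arith derives_fam_member[OF S(1)] v | assumption)+) (simp add: algebra_simps)
qed

text \<open>The projection coefficients are kept as values of their own because all \<open>d\<close>
  entries of the new vector share them; recomputing them for every entry would raise the total from
  order \<open>d^3\<close> to order \<open>d^4\<close>.\<close>

definition gs_block :: "nat \<Rightarrow> ('x \<Rightarrow> nat \<Rightarrow> nat \<Rightarrow> complex) \<Rightarrow> nat \<Rightarrow> ('x \<Rightarrow> complex) set" where
  "gs_block d H j =
     (\<Union>k<j. {\<lambda>x. (\<Sum>l<d. cnj (gs d (H x) k l) * H x l j) / sform d (H x) (gs d (H x) k) (gs d (H x) k)}) \<union>
     (\<Union>i<d. {\<lambda>x. gs d (H x) j i}) \<union>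
     {\<lambda>x. sform d (H x) (gs d (H x) j) (gs d (H x) j)}"

lemma gs_block_gs: "i < d \<Longrightarrow> (\<lambda>x. gs d (H x) j i) \<in> gs_block d H j"
  and gs_block_sform: "(\<lambda>x. sform d (H x) (gs d (H x) j) (gs d (H x) j)) \<in> gs_block d H j"
  unfolding gs_block_def by blast+

lemma derives_gs:
  assumes S: "fam d d (\<lambda>i j x. H x i j) \<subseteq> S"
  shows "derives X (d * (d * (7 * d + 9) + 1)) S (\<Union>j<d. gs_block d H j)"
proof (rule derives_iterate)
  fix j assume j: "j < d"
  let ?cf = "\<lambda>k x. (\<Sum>l<d. cnj (gs d (H x) k l) * H x l j) / sform d (H x) (gs d (H x) k) (gs d (H x) k)"
  let ?V = "S \<union> (\<Union>k<j. gs_block d H k)"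
  let ?A = "\<Union>k<j. {?cf k}" and ?W = "\<Union>i<d. {\<lambda>x. gs d (H x) j i}"
  have V: "fam d d (\<lambda>i j x. H x i j) \<subseteq> ?V" using S by blast
  have gsV: "(\<lambda>x. gs d (H x) k i) \<in> ?V" if "k < j" "i < d" for k i
    using gs_block_gs[OF that(2), of H k] that(1) by blast
  have sfV: "(\<lambda>x. sform d (H x) (gs d (H x) k) (gs d (H x) k)) \<in> ?V" if "k < j" for k
    using gs_block_sform[of d H k] that by blast
  have "derives X (3 * d + 2) ?V {?cf k}" if "k < j" for k
  proof -
    note mem = derives_member[OF gsV[OF that]] derives_member[OF sfV[OF that]]
    show ?thesis
      by (rule derives_le, (rule derives_arith derives_fam_member[OF V] mem j | assumption)+) (simp add: algebra_simps)
  qed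
  then have "derives X (j * (3 * d + 2)) ?V ?A" by (rule derives_UN)
  moreover have "j * (3 * d + 2) \<le> d * (3 * d + 2)" using j by (intro mult_le_mono1) simp
  ultimately have 1: "derives X (d * (3 * d + 2)) ?V ?A" by (rule derives_le)
  have "derives X (2 * d + 3) (?V \<union> ?A) {\<lambda>x. gs d (H x) j i}" if i: "i < d" for i
  proof -
    have mem: "derives X 0 (?V \<union> ?A) {?cf k}" "derives X 0 (?V \<union> ?A) {\<lambda>x. gs d (H x) k i}" if "k < j" for k
      using gsV[OF that i] that by (blast intro: derives_member)+
    have "derives X (1 + (j * (0 + 0 + 1 + 1) + 1) + 1) (?V \<union> ?A)
        {\<lambda>x. of_nat (if i = j then 1 else 0) - (\<Sum>k<j. ?cf k x * gs d (H x) k i)}"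
      by (intro derives_diff derives_sum derives_mult derives_of_nat mem)
    then have "derives X (2 * d + 3) (?V \<union> ?A)
        {\<lambda>x. of_nat (if i = j then 1 else 0) - (\<Sum>k<j. ?cf k x * gs d (H x) k i)}"
      by (rule derives_le) (use j in simp)
    then show ?thesis by (rule derives_cong) (subst (2) gs.simps, simp)
  qed
  then have "derives X (d * (2 * d + 3)) (?V \<union> ?A) ?W" by (rule derives_UN)
  with 1 have 2: "derives X (d * (3 * d + 2) + d * (2 * d + 3)) ?V (?A \<union> ?W)"
    by (rule derives_trans)
  have "derives X (d * (2 * d + 4) + 1) (?V \<union> (?A \<union> ?W))
      {\<lambda>x. sform d (H x) (gs d (H x) j) (gs d (H x) j)}"
    by (rule derives_sform) (use S in blast)+
  with 2 have "derives X (d * (3 * d + 2) + d * (2 * d + 3) + (d * (2 * d + 4) + 1)) ?V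
      (?A \<union> ?W \<union> {\<lambda>x. sform d (H x) (gs d (H x) j) (gs d (H x) j)})"
    by (rule derives_trans)
  moreover have "d * (3 * d + 2) + d * (2 * d + 3) + (d * (2 * d + 4) + 1) = d * (7 * d + 9) + 1"
    by (simp add: distrib_left)
  ultimately show "derives X (d * (7 * d + 9) + 1) ?V (gs_block d H j)"
    by (simp only: gs_block_def)
qed

lemma derives_pd_inverse:
  assumes S: "(\<Union>j<d. gs_block d G j) \<subseteq> S" and i: "i < d" and k: "k < d"
  shows "derives X (4 * d + 1) S {\<lambda>x. pd_inverse d (G x) i k}"
proof -
  have mem: "derives X 0 S {\<lambda>x. gs d (G x) j i}" "derives X 0 S {\<lambda>x. gs d (G x) j k}"
    "derives X 0 S {\<lambda>x. sform d (G x) (gs d (G x) j) (gs d (G x) j)}" if "j < d" for j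
    using S that gs_block_gs[OF i, of G j] gs_block_gs[OF k, of G j] gs_block_sform[of d G j]
    by (blast intro: derives_member)+
  show ?thesis
    unfolding pd_inverse_def
    by (rule derives_le, (rule derives_arith mem | assumption)+) (simp add: algebra_simps)
qed

lemma derives_null_vec:
  assumes S: "(\<Union>j<d. gs_block d H j) \<subseteq> S"
  shows "derives X (d * (1 * (5 * d + 1))) S (fam d 1 (\<lambda>i _ x. null_vec d (H x) i))"
proof (rule derives_fam)
  fix i assume i: "i < d"
  have mem: "derives X 0 S {\<lambda>x. gs d (H x) j i}"
    "derives X 0 S {\<lambda>x. sform d (H x) (gs d (H x) j) (gs d (H x) j)}" if "j < d" for j
    using S that gs_block_gs[OF i, of H j] gs_block_sform[of d H j]
    by (blast intro: derives_member)+
  show "derives X (5 * d + 1) S {\<lambda>x. null_vec d (H x) i}"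
    unfolding null_vec_def
    by (rule derives_le, (rule derives_arith derives_one mem | assumption)+) (simp add: algebra_simps)
qed

text \<open>Each identity is solved for its newest coefficient, starting from the leading
  coefficient 1. The traces that occur have exponents from 1 to \<open>n\<close>, and the divisor
  \<open>Suc r\<close> is a nonzero integer.\<close>

lemma derives_char_poly_coeffs:
  assumes carr: "\<And>x. x \<in> X \<Longrightarrow> A x \<in> carrier_mat n n"
    and S: "\<And>k. 0 < k \<Longrightarrow> k \<le> n \<Longrightarrow> (\<lambda>x. mat_trace (A x ^\<^sub>m k)) \<in> S"
  shows "derives X (Suc n * (2 * n + 6)) S (\<Union>k<Suc n. {\<lambda>x. coeff (char_poly (A x)) (n - k)})"
proof (rule derives_iterate)
  let ?e = "\<lambda>k x. coeff (char_poly (A x)) (n - k)"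
  fix k assume k: "k < Suc n"
  let ?V = "S \<union> (\<Union>j<k. {?e j})"
  show "derives X (2 * n + 6) ?V {?e k}"
  proof (cases k)
    case 0
    have "derives X (2 * n + 6) ?V {\<lambda>_. 1}" by (rule derives_le[OF derives_one]) simp
    then show ?thesis
    proof (rule derives_cong)
      fix x assume "x \<in> X"
      from degree_monic_char_poly[OF carr[OF this]] show "1 = coeff (char_poly (A x)) (n - k)"
        by (simp add: 0)
    qed
  next
    case (Suc r)
    have e: "derives X 0 ?V {?e i}" if "i < Suc r" for i
      using that by (intro derives_member) (auto simp: Suc)
    have p: "derives X 0 ?V {\<lambda>x. mat_trace (A x ^\<^sub>m (Suc r - i))}" if "i < Suc r" for i
      using that k by (intro derives_member UnI1 S) (auto simp: Suc)
    have "derives X (2 * n + 6) ?V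
        {\<lambda>x. (0 - (\<Sum>i<Suc r. ?e i x * mat_trace (A x ^\<^sub>m (Suc r - i)))) / of_nat (Suc r)}"
    proof (rule derives_le)
      show "derives X (1 + (Suc r * (0 + 0 + 1 + 1) + 1) + 1 + 1 + 1) ?V
        {\<lambda>x. (0 - (\<Sum>i<Suc r. ?e i x * mat_trace (A x ^\<^sub>m (Suc r - i)))) / of_nat (Suc r)}"
        by (intro derives_divide derives_diff derives_sum derives_mult derives_zero derives_of_nat e p)
      show "1 + (Suc r * (0 + 0 + 1 + 1) + 1) + 1 + 1 + 1 \<le> 2 * n + 6" using k Suc by simp
    qed
    then show ?thesis
    proof (rule derives_cong)
      fix x assume "x \<in> X"
      have "r < n" using k Suc by simp
      from newton_identities_char_poly[OF carr[OF \<open>x \<in> X\<close>] this]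
      have "of_nat (Suc r) * ?e (Suc r) x = - (\<Sum>i<Suc r. ?e i x * mat_trace (A x ^\<^sub>m (Suc r - i)))"
        by (simp only: lessThan_Suc_atMost)
      then have "?e (Suc r) x = - (\<Sum>i<Suc r. ?e i x * mat_trace (A x ^\<^sub>m (Suc r - i))) / of_nat (Suc r)"
        by (metis nonzero_mult_div_cancel_left of_nat_neq_0)
      then show "(0 - (\<Sum>i<Suc r. ?e i x * mat_trace (A x ^\<^sub>m (Suc r - i)))) / of_nat (Suc r) = ?e k x"
        by (simp only: Suc diff_0)
    qed
  qed
qed

lemma mat_entries_eq:
  assumes "A \<in> carrier_mat n k"
  shows "mat_entries A = map (\<lambda>p. A $$ p) (List.product [0..<n] [0..<k])"
proof -
  have "list_of_vec (row A i) = map (\<lambda>j. A $$ (i, j)) [0..<k]" if "i < n" for i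
    using assms that by (intro nth_equalityI) (auto simp: list_of_vec_index)
  then have "map list_of_vec (rows A) = map (\<lambda>i. map (\<lambda>j. A $$ (i, j)) [0..<k]) [0..<n]"
    using assms by (simp add: rows_def)
  then show ?thesis
    by (simp add: mat_entries_def product_concat_map map_concat o_def)
qed

lemma pow_mat_add:
  fixes A :: "'a :: semiring_1 mat"
  assumes A: "A \<in> carrier_mat n n"
  shows "A ^\<^sub>m i * A ^\<^sub>m j = A ^\<^sub>m (i + j)"
proof (induction j)
  case 0
  show ?case using right_mult_one_mat[of "A ^\<^sub>m i" n n] A by (simp add: carrier_matD(1)[OF A])
next
  case (Suc j)
  have "A ^\<^sub>m i * (A ^\<^sub>m j * A) = A ^\<^sub>m i * A ^\<^sub>m j * A"
    by (rule assoc_mult_mat[symmetric, of _ n n _ n _ n]) (use A in simp_all)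
  then show ?case using Suc by simp
qed

lemma pow_mat_mult:
  fixes A :: "'a :: semiring_1 mat"
  assumes A: "A \<in> carrier_mat n n"
  shows "(A ^\<^sub>m i) ^\<^sub>m j = A ^\<^sub>m (i * j)"
proof (induction j)
  case 0
  show ?case by (simp add: pow_mat_dim_square[OF A])
next
  case (Suc j)
  then show ?case using pow_mat_add[OF A, of "i * j" i] by (simp add: add.commute)
qed

definition fam_list :: "nat \<Rightarrow> nat \<Rightarrow> (nat \<Rightarrow> nat \<Rightarrow> 'x \<Rightarrow> complex) \<Rightarrow> ('x \<Rightarrow> complex) list" where
  "fam_list n k f = map (\<lambda>(i, j). f i j) (List.product [0..<n] [0..<k])"

lemma set_fam_list [simp]: "set (fam_list n k f) = fam n k f"
  by (auto simp: fam_list_def fam_def; blast)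

lemma length_fam_list [simp]: "length (fam_list n k f) = n * k"
  by (simp add: fam_list_def)

lemma map_fam_list_mat:
  "A x \<in> carrier_mat n k \<Longrightarrow> map (\<lambda>f. f x) (fam_list n k (\<lambda>i j x. A x $$ (i, j))) = mat_entries (A x)"
  by (simp add: mat_entries_eq fam_list_def o_def split_def)

text \<open>The summands are the costs of the successive stages of the program, and the last line
  adds the copying of the output. Expanded, they form a polynomial whose coefficients add up to 129,
  rounded up to 200. Every monomial is at most \<open>d^2 m^3\<close>; for those with
  \<open>d^3\<close> one factor \<open>d\<close> is replaced by \<open>m * m\<close>.\<close>

lemma pencil_cost_bound:
  fixes d m :: nat
  assumes "0 < d" "0 < m" "d \<le> m * m"
  shows "d * (m * (m * (4 * m + 3))) + d * (d * (m * (3 * m + 2) + 1)) + d * (d * (m * (3 * m + 2) + 1)) +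
    d * (d * (7 * d + 9) + 1) + d * (d * (4 * d + 1)) + d * (d * (2 * d + 1)) +
    Suc m * (d * (d * (2 * d + 1))) + m * (d * (d * (2 * d + 1))) + Suc m * (m * (d * (2 * d + 2) + 1)) +
    Suc d * (2 * d + 6) + ((d + 1) * 0 + (d + 2) + (d + 1) ^ 3) + d * (d * 2) +
    d * (d * (7 * d + 9) + 1) + d * (1 * (5 * d + 1)) + m * (m * (2 * d + 1)) +
    2 * (d * d + d * d + 1 + d + m * m) + 1 \<le> 200 * (d ^ 2 * m ^ 3)"
    (is "?l \<le> _")
proof -
  have mon: "d ^ a * m ^ b \<le> d ^ 2 * m ^ 3" if "a \<le> 2" "b \<le> 3" for a b
    using assms that by (intro mult_le_mono power_increasing) simp_all
  have mon3: "d ^ 3 * m ^ b \<le> d ^ 2 * m ^ 3" if "b \<le> 1" for b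
  proof -
    have "d ^ 3 * m ^ b = d ^ 2 * (d * m ^ b)" by (simp add: power2_eq_square power3_eq_cube)
    also have "\<dots> \<le> d ^ 2 * (m * m * m ^ b)" using assms by (intro mult_le_mono) simp_all
    also have "\<dots> = d ^ 2 * m ^ (b + 2)" by (simp add: power_add power2_eq_square)
    also have "\<dots> \<le> d ^ 2 * m ^ 3" using that by (intro mon) simp_all
    finally show ?thesis .
  qed
  have monomials: "d ^ 0 * m ^ 0 \<le> d ^ 2 * m ^ 3" "d ^ 0 * m ^ 1 \<le> d ^ 2 * m ^ 3" "d ^ 0 * m ^ 2 \<le> d ^ 2 * m ^ 3"
    "d ^ 1 * m ^ 0 \<le> d ^ 2 * m ^ 3" "d ^ 1 * m ^ 1 \<le> d ^ 2 * m ^ 3" "d ^ 1 * m ^ 2 \<le> d ^ 2 * m ^ 3"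
    "d ^ 1 * m ^ 3 \<le> d ^ 2 * m ^ 3" "d ^ 2 * m ^ 0 \<le> d ^ 2 * m ^ 3" "d ^ 2 * m ^ 1 \<le> d ^ 2 * m ^ 3"
    "d ^ 2 * m ^ 2 \<le> d ^ 2 * m ^ 3" "d ^ 3 * m ^ 0 \<le> d ^ 2 * m ^ 3" "d ^ 3 * m ^ 1 \<le> d ^ 2 * m ^ 3"
    by (rule mon mon3; simp)+
  have "?l = 12 * (d ^ 0 * m ^ 0) + 1 * (d ^ 0 * m ^ 1) + 4 * (d ^ 0 * m ^ 2) + 17 * (d ^ 1 * m ^ 0) + 2 *
      (d ^ 1 * m ^ 1) + 7 * (d ^ 1 * m ^ 2) + 4 * (d ^ 1 * m ^ 3) + 39 * (d ^ 2 * m ^ 0) + 8 * (d ^ 2 * m ^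
      1) + 8 * (d ^ 2 * m ^ 2) + 23 * (d ^ 3 * m ^ 0) + 4 * (d ^ 3 * m ^ 1)"
    by (simp add: power2_eq_square power3_eq_cube algebra_simps)
  also have "\<dots> \<le> 200 * (d ^ 2 * m ^ 3)"
    using monomials by linarith
  finally show ?thesis .
qed

text \<open>The traces of the powers \<open>N\<^sup>k\<close>, \<open>0 < k \<le> d \<le> m\<^sup>2\<close>, come from \<open>k = i + m j\<close> with \<open>i \<le> m\<close>, \<open>j < m\<close>
  (baby steps and giant steps): only about \<open>2 m\<close> matrix products are formed, and the trace of each
  product of a baby and a giant step costs only \<open>O(d\<^sup>2)\<close>.\<close>

lemma pencil_solver:
  assumes "0 < d" "0 < m" "d \<le> m * m"
  shows "\<exists>P. cost P \<le> 200 * (d ^ 2 * m ^ 3) \<and>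
    (\<forall>R Bs. problem_data d m R Bs \<longrightarrow> solves_pencil_problem m R Bs P)"
proof -
  let ?c1 = "d * (m * (m * (4 * m + 3)))"
  let ?c2 = "?c1 + d * (d * (m * (3 * m + 2) + 1))"
  let ?c3 = "?c2 + d * (d * (m * (3 * m + 2) + 1))"
  let ?c4 = "?c3 + d * (d * (7 * d + 9) + 1)"
  let ?c5 = "?c4 + d * (d * (4 * d + 1))"
  let ?c6 = "?c5 + d * (d * (2 * d + 1))"
  let ?c7 = "?c6 + Suc m * (d * (d * (2 * d + 1)))"
  let ?c8 = "?c7 + m * (d * (d * (2 * d + 1)))"
  let ?c9 = "?c8 + Suc m * (m * (d * (2 * d + 2) + 1))"
  let ?c10 = "?c9 + Suc d * (2 * d + 6)"
  let ?c11 = "?c10 + ((d + 1) * 0 + (d + 2) + (d + 1) ^ 3)"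
  let ?c12 = "?c11 + d * (d * 2)"
  let ?c13 = "?c12 + d * (d * (7 * d + 9) + 1)"
  let ?c14 = "?c13 + d * (1 * (5 * d + 1))"
  let ?c15 = "?c14 + m * (m * (2 * d + 1))"
  define X where "X = {x. problem_data d m (fst x) (snd x)}"
  define M where "M = (\<lambda>x :: complex mat \<times> complex mat list. pencil_M (fst x) (snd x))"
  define G where "G = (\<lambda>x :: complex mat \<times> complex mat list. pencil_G (snd x))"
  define Ginv where "Ginv = (\<lambda>x :: complex mat \<times> complex mat list. pencil_problem.G_inv d (snd x))"
  define N where "N = (\<lambda>x. pencil_problem.N d (fst x) (snd x))"
  define C where "C = (\<lambda>k x. commutator (fst x) (snd x ! k) :: complex mat)"
  define l where "l = (\<lambda>x. pencil_problem.l_min d (fst x) (snd x))"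
  define K where "K = (\<lambda>x i j. M x $$ (i, j) - of_real (l x) * G x $$ (i, j))"
  define c where "c = (\<lambda>x. vec d (null_vec d (K x)))"
  define A where "A = (\<lambda>x. mat_lincomb m (snd x) (c x))"
  have problem: "pencil_problem d m (fst x) (snd x)" if "x \<in> X" for x
    using that by unfold_locales (simp add: X_def)
  note carr_R = pencil_problem.R(1)[OF problem] and carr_B = pencil_problem.Bs[OF problem]
  have MX: "M x \<in> carrier_mat d d" and GX: "G x \<in> carrier_mat d d" and GinvX: "Ginv x \<in> carrier_mat d d"
    and NX: "N x \<in> carrier_mat d d" and len: "length (snd x) = d" if "x \<in> X" for x
    using pencil_problem.pencil_carrier[OF problem[OF that]] pencil_problem.G_inv_carrier[OF problem[OF that]]
      pencil_problem.N_carrier[OF problem[OF that]] pencil_problem.length_Bs[OF problem[OF that]]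
    by (simp_all add: M_def G_def Ginv_def N_def)
  have BX: "snd x ! k \<in> carrier_mat m m" if "k < d" "x \<in> X" for k x
    using carr_B[OF that(2,1)] .

  \<comment> \<open>The input as a list of values\<close>
  define fs where "fs = fam_list m m (\<lambda>i j x. fst x $$ (i, j)) @
    concat (map (\<lambda>k. fam_list m m (\<lambda>i j x. (snd x ! k) $$ (i, j))) [0..<d])"
  define inp where "inp = (\<lambda>x :: complex mat \<times> complex mat list. mat_entries (fst x) @ concat (map mat_entries (snd x)))"
  have inp: "inp x = map (\<lambda>f. f x) fs" if x: "x \<in> X" for x
  proof -
    have "map (\<lambda>f. f x) fs = mat_entries (fst x) @
        concat (map (\<lambda>k. map (\<lambda>f. f x) (fam_list m m (\<lambda>i j x. (snd x ! k) $$ (i, j)))) [0..<d])"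
      by (simp add: fs_def map_fam_list_mat[where A = fst and x = x, OF carr_R[OF x]] map_concat o_def)
    also have "map (\<lambda>k. map (\<lambda>f. f x) (fam_list m m (\<lambda>i j x. (snd x ! k) $$ (i, j)))) [0..<d] =
        map (\<lambda>k. mat_entries (snd x ! k)) [0..<d]"
    proof (intro map_cong refl)
      fix k assume "k \<in> set [0..<d]"
      then have "snd x ! k \<in> carrier_mat m m" using x by (intro BX) simp_all
      then show "map (\<lambda>f. f x) (fam_list m m (\<lambda>i j x. (snd x ! k) $$ (i, j))) = mat_entries (snd x ! k)"
        by (rule map_fam_list_mat[where A = "\<lambda>x. snd x ! k" and x = x])
    qed
    also have "\<dots> = map mat_entries (snd x)"
      using len[OF x] by (intro nth_equalityI) simp_all
    finally show ?thesis by (simp add: inp_def)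
  qed

  define U0 where "U0 = set fs"
  define U1 where "U1 = U0 \<union> (\<Union>k<d. fam_mat m (C k))"
  define U2 where "U2 = U1 \<union> fam_mat d M"
  define U3 where "U3 = U2 \<union> fam_mat d G"
  define U4 where "U4 = U3 \<union> (\<Union>j<d. gs_block d (\<lambda>x i j. G x $$ (i, j)) j)"
  define U5 where "U5 = U4 \<union> fam_mat d Ginv"
  define U6 where "U6 = U5 \<union> fam_mat d N"
  define U7 where "U7 = U6 \<union> (\<Union>k<Suc m. fam_mat d (\<lambda>x. N x ^\<^sub>m k))"
  define U8 where "U8 = U7 \<union> (\<Union>k<m. fam_mat d (\<lambda>x. (N x ^\<^sub>m m) ^\<^sub>m k))"
  define U9 where "U9 = U8 \<union> fam (Suc m) m (\<lambda>i j x. mat_trace (N x ^\<^sub>m (i + m * j)))"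
  define U10 where "U10 = U9 \<union> (\<Union>k<Suc d. {\<lambda>x. coeff (char_poly (N x)) (d - k)})"
  define U11 where "U11 = U10 \<union> {\<lambda>x. of_real (l x)}"
  define U12 where "U12 = U11 \<union> fam d d (\<lambda>i j x. K x i j)"
  define U13 where "U13 = U12 \<union> (\<Union>j<d. gs_block d K j)"
  define U14 where "U14 = U13 \<union> fam d 1 (\<lambda>i _ x. null_vec d (K x) i)"
  define U15 where "U15 = U14 \<union> fam_mat m A"
  note U_defs = U1_def U2_def U3_def U4_def U5_def U6_def U7_def U8_def U9_def U10_def
    U11_def U12_def U13_def U14_def U15_def
  have R0: "fam_mat m fst \<subseteq> U0" and B0: "\<And>k. k < d \<Longrightarrow> fam_mat m (\<lambda>x. snd x ! k) \<subseteq> U0"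
    unfolding U0_def fs_def by auto

  \<comment> \<open>The stages of the computation\<close>
  have "derives X 0 U0 U0" by (rule derives_subset) simp
  moreover have "derives X (d * (m * (m * (4 * m + 3)))) U0 (\<Union>k<d. fam_mat m (C k))"
    unfolding C_def by (intro derives_UN derives_commutator R0 B0 carr_R BX)
  ultimately have 1: "derives X (d * (m * (m * (4 * m + 3)))) U0 U1"
    unfolding U1_def by (rule derives_step[where a = 0, simplified])

  have "derives X (d * (d * (m * (3 * m + 2) + 1))) U1 (fam_mat d M)"
  proof (rule derives_fam)
    fix i j assume ij: "i < d" "j < d"
    have "derives X (m * (3 * m + 2) + 1) U1 {\<lambda>x. frob_inner m (C i x) (C j x)}"
      by (rule derives_frob_inner) (use ij in \<open>auto simp: U1_def\<close>)
    then show "derives X (m * (3 * m + 2) + 1) U1 {\<lambda>x. M x $$ (i, j)}"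
      by (rule derives_cong) (simp add: M_def C_def pencil_problem.M_eq[OF problem ij])
  qed
  with 1 have 2: "derives X ?c2 U0 U2"
    unfolding U2_def by (rule derives_step)

  have "derives X (d * (d * (m * (3 * m + 2) + 1))) U2 (fam_mat d G)"
  proof (rule derives_fam)
    fix i j assume ij: "i < d" "j < d"
    have "fam_mat m (\<lambda>x. snd x ! k) \<subseteq> U2" if "k < d" for k
      using B0[OF that] unfolding U_defs by blast
    then have "derives X (m * (3 * m + 2) + 1) U2 {\<lambda>x. frob_inner m (snd x ! i) (snd x ! j)}"
      using ij by (intro derives_frob_inner)
    then show "derives X (m * (3 * m + 2) + 1) U2 {\<lambda>x. G x $$ (i, j)}"
      by (rule derives_cong) (simp add: G_def pencil_problem.G_eq[OF problem ij])
  qed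
  with 2 have 3: "derives X ?c3 U0 U3"
    unfolding U3_def by (rule derives_step)

  have "derives X (d * (d * (7 * d + 9) + 1)) U3 (\<Union>j<d. gs_block d (\<lambda>x i j. G x $$ (i, j)) j)"
    by (rule derives_gs) (simp add: U3_def)
  with 3 have 4: "derives X ?c4 U0 U4"
    unfolding U4_def by (rule derives_step)

  have "derives X (d * (d * (4 * d + 1))) U4 (fam_mat d Ginv)"
  proof (rule derives_fam)
    fix i j assume ij: "i < d" "j < d"
    have "derives X (4 * d + 1) U4 {\<lambda>x. pd_inverse d (\<lambda>i j. G x $$ (i, j)) i j}"
      by (rule derives_pd_inverse) (simp_all add: U4_def ij)
    then show "derives X (4 * d + 1) U4 {\<lambda>x. Ginv x $$ (i, j)}"
      by (rule derives_cong) (simp add: Ginv_def G_def pencil_problem.G_inv_def[OF problem] ij)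
  qed
  with 4 have 5: "derives X ?c5 U0 U5"
    unfolding U5_def by (rule derives_step)

  have "derives X (d * (d * (2 * d + 1))) U5 (fam_mat d N)"
  proof (rule derives_mat_mult)
    show "fam_mat d Ginv \<subseteq> U5" "fam_mat d M \<subseteq> U5" unfolding U_defs by blast+
    show "N x = Ginv x * M x" if "x \<in> X" for x
      by (simp add: N_def Ginv_def M_def pencil_problem.N_def[OF problem[OF that]])
  qed (rule GinvX MX; assumption)+
  with 5 have 6: "derives X ?c6 U0 U6"
    unfolding U6_def by (rule derives_step)

  have "derives X (Suc m * (d * (d * (2 * d + 1)))) U6 (\<Union>k<Suc m. fam_mat d (\<lambda>x. N x ^\<^sub>m k))"
    by (rule derives_mat_powers) (simp_all add: U6_def NX)
  with 6 have 7: "derives X ?c7 U0 U7"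
    unfolding U7_def by (rule derives_step)

  have "derives X (m * (d * (d * (2 * d + 1)))) U7 (\<Union>k<m. fam_mat d (\<lambda>x. (N x ^\<^sub>m m) ^\<^sub>m k))"
    by (rule derives_mat_powers) (auto simp: U7_def NX)
  with 7 have 8: "derives X ?c8 U0 U8"
    unfolding U8_def by (rule derives_step)

  have "derives X (Suc m * (m * (d * (2 * d + 2) + 1))) U8 (fam (Suc m) m (\<lambda>i j x. mat_trace (N x ^\<^sub>m (i + m * j))))"
  proof (rule derives_fam)
    fix i j assume ij: "i < Suc m" "j < m"
    have "derives X (d * (2 * d + 2) + 1) U8 {\<lambda>x. mat_trace (N x ^\<^sub>m i * (N x ^\<^sub>m m) ^\<^sub>m j)}"
    proof (rule derives_trace_mult)
      show "fam_mat d (\<lambda>x. N x ^\<^sub>m i) \<subseteq> U8" "fam_mat d (\<lambda>x. (N x ^\<^sub>m m) ^\<^sub>m j) \<subseteq> U8"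
        using ij unfolding U8_def U7_def by blast+
    qed (simp_all add: NX)
    then show "derives X (d * (2 * d + 2) + 1) U8 {\<lambda>x. mat_trace (N x ^\<^sub>m (i + m * j))}"
      by (rule derives_cong) (simp add: pow_mat_mult[OF NX] pow_mat_add[OF NX])
  qed
  with 8 have 9: "derives X ?c9 U0 U9"
    unfolding U9_def by (rule derives_step)

  have "derives X (Suc d * (2 * d + 6)) U9 (\<Union>k<Suc d. {\<lambda>x. coeff (char_poly (N x)) (d - k)})"
  proof (rule derives_char_poly_coeffs)
    fix k assume k: "0 < k" "k \<le> d"
    \<comment> \<open>Dividing \<open>k - 1\<close> instead of \<open>k\<close> lets
      \<open>i\<close> run from 1 to \<open>m\<close> and keeps \<open>j < m\<close> even for
      \<open>k = m * m\<close>, where dividing \<open>k\<close> would give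
      \<open>j = m\<close>.\<close>
    define i j where "i = Suc ((k - 1) mod m)" and "j = (k - 1) div m"
    have k_eq: "i + m * j = k" using k by (simp add: i_def j_def)
    have "i < Suc m" using \<open>0 < m\<close> by (simp add: i_def)
    moreover have "j < m" using k \<open>d \<le> m * m\<close> \<open>0 < m\<close> by (simp add: j_def less_mult_imp_div_less)
    ultimately have "(\<lambda>x. mat_trace (N x ^\<^sub>m (i + m * j))) \<in> fam (Suc m) m (\<lambda>i j x. mat_trace (N x ^\<^sub>m (i + m * j)))"
      by (rule fam_memberI)
    then show "(\<lambda>x. mat_trace (N x ^\<^sub>m k)) \<in> U9"
      unfolding k_eq U9_def by (rule UnI2)
  qed (rule NX)
  with 9 have 10: "derives X ?c10 U0 U10"
    unfolding U10_def by (rule derives_step)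

  have "derives X ((d + 1) * 0 + (d + 2) + (d + 1) ^ 3) U10
      {\<lambda>x. of_real (least_real_root (Poly (map (\<lambda>i. coeff (char_poly (N x)) i) [0..<d + 1])))}"
  proof (rule derives_least_real_root)
    fix i assume "i \<le> d"
    then have "(\<lambda>x. coeff (char_poly (N x)) i) \<in> (\<Union>k<Suc d. {\<lambda>x. coeff (char_poly (N x)) (d - k)})"
      by (intro UN_I[of "d - i"]) simp_all
    then show "derives X 0 U10 {\<lambda>x. coeff (char_poly (N x)) i}"
      unfolding U10_def by (intro derives_member UnI2)
  qed
  then have "derives X ((d + 1) * 0 + (d + 2) + (d + 1) ^ 3) U10 {\<lambda>x. of_real (l x)}"
  proof (rule derives_cong)
    fix x assume x: "x \<in> X"
    have "degree (char_poly (N x)) = d" using degree_monic_char_poly[OF NX[OF x]] by simp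
    then have "Poly (map (\<lambda>i. coeff (char_poly (N x)) i) [0..<d + 1]) = char_poly (N x)"
      by (intro poly_eqI) (auto simp: nth_default_def coeff_eq_0 simp del: upt_Suc)
    then show "complex_of_real (least_real_root (Poly (map (\<lambda>i. coeff (char_poly (N x)) i) [0..<d + 1]))) = of_real (l x)"
      by (simp only: N_def l_def pencil_problem.least_real_root_N[OF problem[OF x]])
  qed
  with 10 have 11: "derives X ?c11 U0 U11"
    unfolding U11_def by (rule derives_step)

  have "derives X (d * (d * 2)) U11 (fam d d (\<lambda>i j x. K x i j))"
  proof (rule derives_fam)
    fix i j assume ij: "i < d" "j < d"
    have sub: "fam_mat d M \<subseteq> U11" "fam_mat d G \<subseteq> U11" "(\<lambda>x. of_real (l x)) \<in> U11" unfolding U_defs by blast+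
    show "derives X 2 U11 {\<lambda>x. K x i j}"
      unfolding K_def
      by (rule derives_le, (rule derives_arith derives_fam_member[OF sub(1)] derives_fam_member[OF sub(2)]
            derives_member[OF sub(3)] ij)+) simp
  qed
  with 11 have 12: "derives X ?c12 U0 U12"
    unfolding U12_def by (rule derives_step)

  have "derives X (d * (d * (7 * d + 9) + 1)) U12 (\<Union>j<d. gs_block d K j)"
    by (rule derives_gs) (simp add: U12_def)
  with 12 have 13: "derives X ?c13 U0 U13"
    unfolding U13_def by (rule derives_step)

  have "derives X (d * (1 * (5 * d + 1))) U13 (fam d 1 (\<lambda>i _ x. null_vec d (K x) i))"
    by (rule derives_null_vec) (simp add: U13_def)
  with 13 have 14: "derives X ?c14 U0 U14"
    unfolding U14_def by (rule derives_step)

  have "derives X (m * (m * (2 * d + 1))) U14 (fam_mat m A)"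
  proof (rule derives_fam)
    fix i k assume ik: "i < m" "k < m"
    have v: "derives X 0 U14 {\<lambda>x. null_vec d (K x) j}" if "j < d" for j
      by (rule derives_fam_member[of d 1 _ U14 _ 0]) (use that in \<open>auto simp: U14_def\<close>)
    have B: "derives X 0 U14 {\<lambda>x. (snd x ! j) $$ (i, k)}" if "j < d" for j
    proof (rule derives_fam_member)
      have "U0 \<subseteq> U14" unfolding U_defs by (rule subset_refl | rule le_supI1)+
      with B0[OF that] show "fam_mat m (\<lambda>x. snd x ! j) \<subseteq> U14" by (rule subset_trans)
    qed (rule ik)+
    have "derives X (2 * d + 1) U14 {\<lambda>x. \<Sum>j<d. null_vec d (K x) j * (snd x ! j) $$ (i, k)}"
      by (rule derives_le, (rule derives_arith v B | assumption)+) simp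
    then show "derives X (2 * d + 1) U14 {\<lambda>x. A x $$ (i, k)}"
      by (rule derives_cong) (simp add: A_def c_def mat_lincomb_def len ik)
  qed
  with 14 have 15: "derives X ?c15 U0 U15"
    unfolding U15_def by (rule derives_step)

  \<comment> \<open>The output and its correctness\<close>
  define os where "os = fam_list d d (\<lambda>i j x. M x $$ (i, j)) @ fam_list d d (\<lambda>i j x. G x $$ (i, j)) @
    [\<lambda>x. of_real (l x)] @ map (\<lambda>i x. null_vec d (K x) i) [0..<d] @ fam_list m m (\<lambda>i j x. A x $$ (i, j))"
  have os: "set os \<subseteq> U0 \<union> U15"
  proof (rule le_supI2)
    have sub: "U2 \<subseteq> U15" "U3 \<subseteq> U15" "U11 \<subseteq> U15" "U14 \<subseteq> U15"
      unfolding U_defs by (rule subset_refl | rule le_supI1)+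
    have "fam_mat d M \<subseteq> U15" using sub(1) unfolding U2_def by (rule le_supE)
    moreover have "fam_mat d G \<subseteq> U15" using sub(2) unfolding U3_def by (rule le_supE)
    moreover have "{\<lambda>x. of_real (l x)} \<subseteq> U15" using sub(3) unfolding U11_def by (rule le_supE)
    moreover have "set (map (\<lambda>i x. null_vec d (K x) i) [0..<d]) \<subseteq> U15"
    proof
      fix f assume "f \<in> set (map (\<lambda>i x. null_vec d (K x) i) [0..<d])"
      then obtain i where i: "i < d" "f = (\<lambda>x. null_vec d (K x) i)" by auto
      then have "f \<in> U14"
        using fam_memberI[OF i(1), of 0 1 "\<lambda>i _ x. null_vec d (K x) i"] unfolding U14_def by simp
      with sub(4) show "f \<in> U15" by (rule subsetD)
    qed
    moreover have "fam_mat m A \<subseteq> U15" unfolding U15_def by (rule Un_upper2)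
    ultimately show "set os \<subseteq> U15" unfolding os_def set_append set_fam_list list.set
      by (intro Un_least) simp_all
  qed
  have "computed X (\<lambda>x. load (inp x)) 0 U0"
    unfolding U0_def using inp by (rule computed_load)
  with 15 have "computed X (\<lambda>x. load (inp x)) (0 + ?c15) (U0 \<union> U15)"
    by (rule derives_computed)
  from computed_mono[OF this os order_refl] have "computed X (\<lambda>x. load (inp x)) ?c15 (set os)"
    by (simp only: add_0)
  from computed_computes[OF this] obtain P where cost: "cost P \<le> ?c15 + 2 * length os + 1"
    and P: "\<forall>x\<in>X. computes P (inp x) (map (\<lambda>f. f x) os)"
    by (elim exE conjE)
  show ?thesis
  proof (intro exI[of _ P] conjI allI impI)
    have length_os: "length os = d * d + d * d + 1 + d + m * m" by (simp add: os_def)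
    show "cost P \<le> 200 * (d ^ 2 * m ^ 3)"
      using cost[unfolded length_os] pencil_cost_bound[OF assms] by (rule order_trans)
    fix R Bs assume data: "problem_data d m R Bs"
    define x where "x = (R, Bs)"
    have x: "x \<in> X" using data by (simp add: X_def x_def)
    have "map (\<lambda>f. f x) os = mat_entries (M x) @ mat_entries (G x) @ [of_real (l x)] @ list_of_vec (c x) @ mat_entries (A x)"
      using map_fam_list_mat[where A = M and x = x, OF MX[OF x]] map_fam_list_mat[where A = G and x = x, OF GX[OF x]]
        map_fam_list_mat[where A = A and x = x, of m m]
      by (simp add: os_def c_def o_def A_def mat_lincomb_def)
    with bspec[OF P x] have "computes P (mat_entries R @ concat (map mat_entries Bs))
       (mat_entries (pencil_M R Bs) @ mat_entries (pencil_G Bs) @ [of_real (l x)] @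
         list_of_vec (c x) @ mat_entries (mat_lincomb m Bs (c x)))"
      by (simp add: inp_def x_def M_def G_def A_def)
    moreover have "smallest_gen_eigenvalue (pencil_M R Bs) (pencil_G Bs) (l x)"
      using pencil_problem.smallest_l_min[OF problem[OF x]] by (simp add: l_def x_def)
    moreover have "gen_eigenvector (pencil_M R Bs) (pencil_G Bs) (of_real (l x)) (c x)"
      using pencil_problem.null_vec_eigvec[OF problem[OF x]] by (simp add: c_def K_def M_def G_def l_def x_def)
    ultimately show "solves_pencil_problem m R Bs P"
      unfolding solves_pencil_problem_def by blast
  qed
qed

theorem theorem7p3:
  shows "(\<forall>(d::nat) (m::nat) R Bs. problem_data d m R Bs \<longrightarrow>
            pencil_M R Bs \<in> carrier_mat d d \<and> hermitian_mat (pencil_M R Bs) \<and>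
            pencil_G Bs \<in> carrier_mat d d \<and> hermitian_mat (pencil_G Bs) \<and>
            (\<exists>l_min::real. smallest_gen_eigenvalue (pencil_M R Bs) (pencil_G Bs) l_min \<and>
               {A. is_arg_min (commutator_quotient R) (\<lambda>X. X \<in> mat_span m Bs - {0\<^sub>m m m}) A} =
               {mat_lincomb m Bs c | c.
                  gen_eigenvector (pencil_M R Bs) (pencil_G Bs) (of_real l_min) c}))
       \<and> (\<exists>P :: nat \<Rightarrow> nat \<Rightarrow> prog.
            (\<forall>d m R Bs. problem_data d m R Bs \<longrightarrow> solves_pencil_problem m R Bs (P d m)) \<and>
            (\<lambda>(d, m). real (cost (P d m))) \<in> O[principal UNIV](\<lambda>(d, m). real (d ^ 2 * m ^ 3 + d ^ 3)))"
proof (intro conjI allI impI)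
  fix d m :: nat and R Bs
  assume "problem_data d m R Bs"
  then interpret pencil_problem d m R Bs by unfold_locales
  show "pencil_M R Bs \<in> carrier_mat d d" "hermitian_mat (pencil_M R Bs)"
    "pencil_G Bs \<in> carrier_mat d d" "hermitian_mat (pencil_G Bs)"
    by (fact pencil_carrier hermitian_pencil)+
  show "\<exists>l_min::real. smallest_gen_eigenvalue (pencil_M R Bs) (pencil_G Bs) l_min \<and>
      {A. is_arg_min (commutator_quotient R) (\<lambda>X. X \<in> mat_span m Bs - {0\<^sub>m m m}) A} =
      {mat_lincomb m Bs c | c. gen_eigenvector (pencil_M R Bs) (pencil_G Bs) (of_real l_min) c}"
    by (intro exI[of _ l_min] conjI smallest_l_min minimizers)
next
  \<comment> \<open>The family \<open>P\<close> has to be given for all sizes, and the filter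
    \<open>principal UNIV\<close> demands the bound at every pair, not just eventually. Sizes with
    \<open>d = 0\<close>, \<open>m = 0\<close> or \<open>d > m * m\<close> admit no problem data, so
    the empty program of cost 0 serves there.\<close>
  have "\<exists>P. cost P \<le> 200 * (d ^ 2 * m ^ 3) \<and>
      (\<forall>R Bs. problem_data d m R Bs \<longrightarrow> solves_pencil_problem m R Bs P)" for d m
  proof (cases "0 < d \<and> 0 < m \<and> d \<le> m * m")
    case True
    then show ?thesis by (intro pencil_solver) simp_all
  next
    case False
    have "\<not> problem_data d m R Bs" for R Bs
    proof
      assume "problem_data d m R Bs"
      then interpret pencil_problem d m R Bs by unfold_locales
      show False using False d_pos d_le by (cases "m = 0") auto
    qed
    then show ?thesis by (intro exI[of _ Skip]) simp
  qed
  then obtain P where P: "\<And>d m. cost (P d m) \<le> 200 * (d ^ 2 * m ^ 3)"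
    "\<And>d m R Bs. problem_data d m R Bs \<Longrightarrow> solves_pencil_problem m R Bs (P d m)"
    by metis
  have "real (cost (P d m)) \<le> 200 * real (d ^ 2 * m ^ 3 + d ^ 3)" for d m
  proof -
    have "cost (P d m) \<le> 200 * (d ^ 2 * m ^ 3 + d ^ 3)" using P(1)[of d m] by simp
    then have "real (cost (P d m)) \<le> real (200 * (d ^ 2 * m ^ 3 + d ^ 3))" by (simp only: of_nat_le_iff)
    then show ?thesis by simp
  qed
  then have "(\<lambda>(d, m). real (cost (P d m))) \<in> O[principal UNIV](\<lambda>(d, m). real (d ^ 2 * m ^ 3 + d ^ 3))"
    by (intro landau_o.bigI[of 200]) (auto simp: eventually_principal)
  with P(2) show "\<exists>P :: nat \<Rightarrow> nat \<Rightarrow> prog.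
      (\<forall>d m R Bs. problem_data d m R Bs \<longrightarrow> solves_pencil_problem m R Bs (P d m)) \<and>
      (\<lambda>(d, m). real (cost (P d m))) \<in> O[principal UNIV](\<lambda>(d, m). real (d ^ 2 * m ^ 3 + d ^ 3))"
    by blast
qed

end
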